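(* In the setting of the context, assume that the random vector $E_0$ is independent of the process $(\mathbf W_t)_{t\in[0,T]}$, and let $\rho_{i,j}:=\Sigma_{i,j}/(\Sigma_{i,i}\Sigma_{j,j})^{1/2}$. Then for any $1\le k\le M-1$ and $1\le i<j\le d$, the estimated correlation $$R^{i,j}_{[t_k,t_{k+1}]}:=\frac{C^{i,j}_{[t_k,t_{k+1}]}}{\big(C^{i,i}_{[t_k,t_{k+1}]}C^{j,j}_{[t_k,t_{k+1}]}\big)^{1/2}}$$ satisfies $$ R^{i,j}_{[t_k,t_{k+1}]}=\rho_{i,j}\left(\frac{(t_{k+1}-t_k)^2\,\Sigma_{i,i}\Sigma_{j,j}}{C^{i,i}_{[t_k,t_{k+1}]}C^{j,j}_{[t_k,t_{k+1}]}}\right)^{1/2}+\frac{\alpha_i\alpha_j\eta_i\eta_j\,\Lambda_k^{i,j}}{4V_iV_j\big(C^{i,i}_{[t_k,t_{k+1}]}C^{j,j}_{[t_k,t_{k+1}]}\big)^{1/2}}+\epsilon_N=:\rho_{i,j}A_k^{i,j}+B_k^{i,j}+\epsilon_N, $$ where $\epsilon_N\to0$ as $N\to\infty$.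
   Context: Fix $d\ge1$, $T>0$, scalars $\sigma_i,V_i,\eta_i>0$, $\alpha_i\ge0$, $\gamma\ge0$, and $\mathbf A=\mathrm{diag}(A_1,\dots,A_d)$ with $A_i>0$. Put $\mathbb A=\mathrm{diag}(\alpha_1,\dots,\alpha_d)$ and $\mathbb V=\mathrm{diag}(\frac{V_1}{4\eta_1},\dots,\frac{V_d}{4\eta_d})$. Let $\mathbf W=(\sigma_1W^1,\dots,\sigma_dW^d)$, where $W^1,\dots,W^d$ are correlated Wiener processes, and let $\Sigma$ be the nonsingular covariance matrix of $\mathbf W$ (per unit time, i.e. $\mathrm{Cov}(\mathbf W_t)=t\Sigma$). Mean field (identical preferences). Let $E_0$ be an $\mathbb R^d$-valued random vector with finite second moments. $\mathbf E=(E^1,\dots,E^d)$ is the solution on $[0,T]$ of $$\ddot{\mathbf E}=-2\mathbb V\mathbb A\dot{\mathbf E}+2\gamma\mathbb V\Sigma\mathbf E,\qquad \mathbf E(0)=E_0,\qquad \dot{\mathbf E}(T)+4\mathbb V\mathbf A\mathbf E(T)=0,$$ where $|\mathbb A|$ is assumed small enough that this problem is uniquely solvable, and $\boldsymbol\mu=(\mu^1,\dots,\mu^d):=\dot{\mathbf E}$. The symmetric matrix function $\mathbb H=(\mathbb H^{n,\ell})$ is the solution on $[0,T]$ of the Riccati equation $\dot{\mathbb H}=-2\mathbb H\mathbb V\mathbb H+\gamma\Sigma$, $\mathbb H(T)=-2\mathbf A$, and $$\mathbb G(t,w):=\exp\Big\{\int_t^w2\mathbb H(s)\mathbb V\,ds\Big\}\mathbb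 A ,\qquad \mathbb G=(\mathbb G^{n,\ell}).$$ Prices and estimator. On each trading day the prices follow $dS^i_t=\sigma_i\,dW^i_t+\alpha_i\mu^i_t\,dt$, $t\in[0,T]$, $i=1,\dots,d$. One observes $N$ independent days $l=1,\dots,N$, each with its own independent realization of $(E_0,\mathbf W)$, at times $0=t_1<\dots<t_M=T$ (the same every day); $S^{n}_{t_{l,k}}$ is the price of asset $n$ at time $t_k$ of day $l$. Set $\delta S^{n,k,l}=S^n_{t_{l,k+1}}-S^n_{t_{l,k}}$, $\overline{\delta S}^{n,k}=N^{-1}\sum_{l=1}^N\delta S^{n,k,l}$, and $$C^{i,j}_{[t_k,t_{k+1}]}:=\frac1{N-1}\sum_{l=1}^N\big(\delta S^{i,k,l}-\overline{\delta S}^{i,k}\big)\big(\delta S^{j,k,l}-\overline{\delta S}^{j,k}\big).$$ Excess term. With $\langle X,Y\rangle$ the covariance of random variables $X,Y$, $$ \Lambda_k^{i,j}:=\sum_{1\le\ell,\ell'\le d}\Big(\langle\theta_k^{i,\ell},\theta_k^{j,\ell'}\rangle+\langle\pi_k^{i,\ell},\theta_k^{j,\ell'}\rangle+\langle\theta_k^{i,\ell},\pi_k^{j,\ell'}\rangle+\langle\pi_k^{i,\ell},\pi_k^{j,\ell'}\rangle\Big), $$ $$ \pi_k^{n,\ell}:=\int_{t_k}^{t_{k+1}}\mathbb H^{n,\ell}(s)E^\ell(s)\,ds,\qquad \theta_k^{n,\ell}:=\int_{t_k}^{t_{k+1}}\int_s^T\mathbb G^{n,\ell}(s,w)\,\mu^\ell(w)\,dw\,ds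 . $$ The term $\epsilon_N$ is an estimation noise, and its convergence to $0$ is in the sense of the law of large numbers over the $N$ days.
   Formalization: The printed claim is false: the coefficient of Λ is corrected from α_iα_jη_iη_j/(4V_iV_j) to α_iα_jV_iV_j/(4η_iη_j), and the exponential in G is taken as the time-ordered one (equal to the plain exponential when the matrices H(s)V commute). *)

theory Defs
  imports "HOL-Probability.Probability"
begin

definition diag_mat :: "('d \<Rightarrow> real) \<Rightarrow> real^'d^'d" where
  "diag_mat c = (\<chi> i j. if i = j then c i else 0)"

definition covariance :: "'a measure \<Rightarrow> ('a \<Rightarrow> real) \<Rightarrow> ('a \<Rightarrow> real) \<Rightarrow> real" where
  "covariance P X Y =
     (LINT \<omega>|P. (X \<omega> - integral\<^sup>L P X) * (Y \<omega> - integral\<^sup>L P Y))"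


(* The library's indep_var needs both random variables to take values in the same type. *)
definition independent_rv ::
  "'a measure \<Rightarrow> 'b measure \<Rightarrow> ('a \<Rightarrow> 'b) \<Rightarrow> 'c measure \<Rightarrow> ('a \<Rightarrow> 'c) \<Rightarrow> bool" where
  "independent_rv P M X N Y \<longleftrightarrow>
     X \<in> measurable P M \<and> Y \<in> measurable P N \<and>
     prob_space.indep_set P {X -` B \<inter> space P | B. B \<in> sets M} {Y -` B \<inter> space P | B. B \<in> sets N}"


subsection \<open>Correlated Wiener processes on a finite horizon\<close>

(* The case s = 0 is the point mass at m, so that degenerate linear combinations of a
   Gaussian vector are included. *)
definition normal_law :: "real \<Rightarrow> real \<Rightarrow> real measure" where
  "normal_law m s =
     (if s = 0 then return borel m else density lborel (\<lambda>x. ennreal (normal_density m s x)))"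

definition has_independent_increments ::
  "'a measure \<Rightarrow> real \<Rightarrow> (real \<Rightarrow> 'a \<Rightarrow> 'b::euclidean_space) \<Rightarrow> bool" where
  "has_independent_increments P T X \<longleftrightarrow>
     (\<forall>(m::nat) (u::nat \<Rightarrow> real).
        (\<forall>k\<le>m. u k \<in> {0..T}) \<and> (\<forall>k<m. u k \<le> u (Suc k)) \<longrightarrow>
        prob_space.indep_vars P (\<lambda>_. borel) (\<lambda>k \<omega>. X (u (Suc k)) \<omega> - X (u k) \<omega>) {..<m})"

definition wiener_process :: "'a measure \<Rightarrow> real \<Rightarrow> (real \<Rightarrow> 'a \<Rightarrow> real) \<Rightarrow> bool" where
  "wiener_process P T X \<longleftrightarrow>
     (\<forall>s\<in>{0..T}. X s \<in> borel_measurable P) \<and>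
     (AE \<omega> in P. X 0 \<omega> = 0) \<and>
     (AE \<omega> in P. continuous_on {0..T} (\<lambda>s. X s \<omega>)) \<and>
     has_independent_increments P T X \<and>
     (\<forall>s u. 0 \<le> s \<and> s \<le> u \<and> u \<le> T \<longrightarrow>
        distr P borel (\<lambda>\<omega>. X u \<omega> - X s \<omega>) = normal_law 0 (sqrt (u - s)))"

(* Each coordinate is a standard Wiener process; jointly, the vector of coordinates is Gaussian
   with independent increments. *)
definition correlated_wiener_processes ::
  "'a measure \<Rightarrow> real \<Rightarrow> (real \<Rightarrow> 'a \<Rightarrow> real^'d) \<Rightarrow> bool" where
  "correlated_wiener_processes P T W \<longleftrightarrow>
     (\<forall>i. wiener_process P T (\<lambda>s \<omega>. W s \<omega> $ i)) \<and>
     has_independent_increments P T W \<and>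
     (\<forall>s\<in>{0..T}. \<forall>u\<in>{0..T}. \<forall>v. \<exists>m r. 0 \<le> r \<and>
        distr P borel (\<lambda>\<omega>. v \<bullet> (W u \<omega> - W s \<omega>)) = normal_law m r)"

(* A path restricted to the horizon, as a point of the product space PiM {0..T} (\<lambda>_. borel). *)
definition path_on :: "real \<Rightarrow> (real \<Rightarrow> 'a \<Rightarrow> 'b) \<Rightarrow> 'a \<Rightarrow> real \<Rightarrow> 'b" where
  "path_on T X \<omega> = restrict (\<lambda>s. X s \<omega>) {0..T}"

abbreviation path_space :: "real \<Rightarrow> (real \<Rightarrow> real^'d) measure" where
  "path_space T \<equiv> PiM {0..T} (\<lambda>_. borel)"


subsection \<open>The mean field system\<close>

definition VV :: "('d \<Rightarrow> real) \<Rightarrow> ('d \<Rightarrow> real) \<Rightarrow> real^'d^'d" where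
  "VV V \<eta> = diag_mat (\<lambda>i. V i / (4 * \<eta> i))"

(* The second-order boundary value problem for E, written for the pair (E, \<mu>) with \<mu> the
   derivative of E. *)
definition mean_field_solution ::
  "real \<Rightarrow> real^'d^'d \<Rightarrow> real^'d^'d \<Rightarrow> real^'d^'d \<Rightarrow> real \<Rightarrow> real^'d^'d \<Rightarrow> real^'d \<Rightarrow>
   (real \<Rightarrow> real^'d) \<Rightarrow> (real \<Rightarrow> real^'d) \<Rightarrow> bool" where
  "mean_field_solution T \<V> \<A> A \<gamma> \<Sigma> x E \<mu> \<longleftrightarrow>
     (\<forall>s\<in>{0..T}. (E has_vector_derivative \<mu> s) (at s within {0..T})) \<and>
     (\<forall>s\<in>{0..T}. (\<mu> has_vector_derivative
        (- 2) *\<^sub>R ((\<V> ** \<A>) *v \<mu> s) + (2 * \<gamma>) *\<^sub>R ((\<V> ** \<Sigma>) *v E s)) (at s within {0..T})) \<and>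
     E 0 = x \<and>
     \<mu> T + 4 *\<^sub>R ((\<V> ** A) *v E T) = 0"

definition mean_field_uniquely_solvable ::
  "real \<Rightarrow> real^'d^'d \<Rightarrow> real^'d^'d \<Rightarrow> real^'d^'d \<Rightarrow> real \<Rightarrow> real^'d^'d \<Rightarrow> bool" where
  "mean_field_uniquely_solvable T \<V> \<A> A \<gamma> \<Sigma> \<longleftrightarrow>
     (\<forall>x. \<exists>E \<mu>. mean_field_solution T \<V> \<A> A \<gamma> \<Sigma> x E \<mu> \<and>
        (\<forall>E' \<mu>'. mean_field_solution T \<V> \<A> A \<gamma> \<Sigma> x E' \<mu>' \<longrightarrow>
           (\<forall>s\<in>{0..T}. E' s = E s \<and> \<mu>' s = \<mu> s)))"

definition riccati_solution ::
  "real \<Rightarrow> real^'d^'d \<Rightarrow> real^'d^'d \<Rightarrow> real \<Rightarrow> real^'d^'d \<Rightarrow> (real \<Rightarrow> real^'d^'d) \<Rightarrow> bool" where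
  "riccati_solution T \<V> A \<gamma> \<Sigma> H \<longleftrightarrow>
     (\<forall>s\<in>{0..T}. transpose (H s) = H s) \<and>
     (\<forall>s\<in>{0..T}. (H has_vector_derivative
        (- 2) *\<^sub>R (H s ** \<V> ** H s) + \<gamma> *\<^sub>R \<Sigma>) (at s within {0..T})) \<and>
     H T = (- 2) *\<^sub>R A"

(* \<Phi> t w is the time-ordered exponential exp{\<integral> K(s) ds, s from t to w} (earlier times to the
   left), that is, the propagator of x' = - K x from time w back to time t. It is the ordinary
   exponential of the integral when the matrices K s commute with each other. The matrices
   K s = 2 H(s) VV do not commute in general, and only the time-ordered exponential yields
   \<mu>(t) = 2 VV (H(t) E(t) + \<integral> \<Phi>(t,w) diag(\<alpha>) \<mu>(w) dw, w from t to T). *)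
definition is_ordered_exponential ::
  "real \<Rightarrow> (real \<Rightarrow> real^'d^'d) \<Rightarrow> (real \<Rightarrow> real \<Rightarrow> real^'d^'d) \<Rightarrow> bool" where
  "is_ordered_exponential T K \<Phi> \<longleftrightarrow>
     (\<forall>w\<in>{0..T}. \<Phi> w w = mat 1 \<and>
        (\<forall>s\<in>{0..w}. ((\<lambda>t. \<Phi> t w) has_vector_derivative - (K s ** \<Phi> s w)) (at s within {0..w})))"


subsection \<open>The excess term\<close>

definition pi_term ::
  "(nat \<Rightarrow> real) \<Rightarrow> (real \<Rightarrow> real^'d^'d) \<Rightarrow> nat \<Rightarrow> 'd \<Rightarrow> 'd \<Rightarrow> (real \<Rightarrow> real^'d) \<Rightarrow> real" where
  "pi_term t H k n l E = integral {t k..t (k + 1)} (\<lambda>s. H s $ n $ l * E s $ l)"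

definition theta_term ::
  "(nat \<Rightarrow> real) \<Rightarrow> real \<Rightarrow> (real \<Rightarrow> real \<Rightarrow> real^'d^'d) \<Rightarrow> nat \<Rightarrow> 'd \<Rightarrow> 'd \<Rightarrow>
   (real \<Rightarrow> real^'d) \<Rightarrow> real" where
  "theta_term t T G k n l \<mu> =
     integral {t k..t (k + 1)} (\<lambda>s. integral {s..T} (\<lambda>w. G s w $ n $ l * \<mu> w $ l))"

definition excess ::
  "'a measure \<Rightarrow> (nat \<Rightarrow> real) \<Rightarrow> real \<Rightarrow> (real \<Rightarrow> real^'d^'d) \<Rightarrow> (real \<Rightarrow> real \<Rightarrow> real^'d^'d) \<Rightarrow>
   ('a \<Rightarrow> real \<Rightarrow> real^'d) \<Rightarrow> ('a \<Rightarrow> real \<Rightarrow> real^'d) \<Rightarrow> nat \<Rightarrow> 'd \<Rightarrow> 'd \<Rightarrow> real" where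
  "excess P t T H G E \<mu> k i j =
     (let \<pi> = (\<lambda>n l \<omega>. pi_term t H k n l (E \<omega>));
          \<theta> = (\<lambda>n l \<omega>. theta_term t T G k n l (\<mu> \<omega>))
      in \<Sum>l\<in>UNIV. \<Sum>l'\<in>UNIV.
           covariance P (\<theta> i l) (\<theta> j l') + covariance P (\<pi> i l) (\<theta> j l') +
           covariance P (\<theta> i l) (\<pi> j l') + covariance P (\<pi> i l) (\<pi> j l'))"


subsection \<open>The estimators, for observed price paths S 1, S 2, ...\<close>

definition price_incr ::
  "(nat \<Rightarrow> real) \<Rightarrow> (nat \<Rightarrow> real \<Rightarrow> real^'d) \<Rightarrow> 'd \<Rightarrow> nat \<Rightarrow> nat \<Rightarrow> real" where
  "price_incr t S n k l = S l (t (k + 1)) $ n - S l (t k) $ n"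

definition mean_incr ::
  "(nat \<Rightarrow> real) \<Rightarrow> (nat \<Rightarrow> real \<Rightarrow> real^'d) \<Rightarrow> nat \<Rightarrow> 'd \<Rightarrow> nat \<Rightarrow> real" where
  "mean_incr t S N n k = (\<Sum>l=1..N. price_incr t S n k l) / real N"

definition sample_cov ::
  "(nat \<Rightarrow> real) \<Rightarrow> (nat \<Rightarrow> real \<Rightarrow> real^'d) \<Rightarrow> nat \<Rightarrow> nat \<Rightarrow> 'd \<Rightarrow> 'd \<Rightarrow> real" where
  "sample_cov t S N k i j =
     (\<Sum>l=1..N. (price_incr t S i k l - mean_incr t S N i k) *
               (price_incr t S j k l - mean_incr t S N j k)) / (real N - 1)"

definition estimated_corr ::
  "(nat \<Rightarrow> real) \<Rightarrow> (nat \<Rightarrow> real \<Rightarrow> real^'d) \<Rightarrow> nat \<Rightarrow> nat \<Rightarrow> 'd \<Rightarrow> 'd \<Rightarrow> real" where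
  "estimated_corr t S N k i j =
     sample_cov t S N k i j / sqrt (sample_cov t S N k i i * sample_cov t S N k j j)"

definition A_coeff ::
  "(nat \<Rightarrow> real) \<Rightarrow> real^'d^'d \<Rightarrow> (nat \<Rightarrow> real \<Rightarrow> real^'d) \<Rightarrow> nat \<Rightarrow> nat \<Rightarrow> 'd \<Rightarrow> 'd \<Rightarrow> real" where
  "A_coeff t \<Sigma> S N k i j =
     sqrt ((t (k + 1) - t k)\<^sup>2 * (\<Sigma> $ i $ i * \<Sigma> $ j $ j) /
           (sample_cov t S N k i i * sample_cov t S N k j j))"

(* The factor V i * V j / (4 * \<eta> i * \<eta> j) is the product of the i-th and j-th diagonal entries of
   2 VV, which multiply the drift. The paper prints the reciprocal ratio
   \<eta> i * \<eta> j / (4 * V i * V j), which is inconsistent with VV = diag (V i / (4 * \<eta> i)) and makes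
   the asserted convergence false. *)
definition B_coeff ::
  "(nat \<Rightarrow> real) \<Rightarrow> ('d \<Rightarrow> real) \<Rightarrow> ('d \<Rightarrow> real) \<Rightarrow> ('d \<Rightarrow> real) \<Rightarrow> ('d \<Rightarrow> 'd \<Rightarrow> real) \<Rightarrow>
   (nat \<Rightarrow> real \<Rightarrow> real^'d) \<Rightarrow> nat \<Rightarrow> nat \<Rightarrow> 'd \<Rightarrow> 'd \<Rightarrow> real" where
  "B_coeff t \<alpha> V \<eta> \<Lambda> S N k i j =
     \<alpha> i * \<alpha> j * V i * V j * \<Lambda> i j /
       (4 * \<eta> i * \<eta> j * sqrt (sample_cov t S N k i i * sample_cov t S N k j j))"

end

theory Submission
  imports Defs
begin

text \<open>
  By unique solvability \<open>E\<close> and \<open>\<mu>\<close> depend linearly on \<open>E\<^sub>0\<close>, so the drift part of a price increment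
  is a linear functional of \<open>E\<^sub>0\<close>. It is independent of the Brownian part, hence the increments have
  covariance \<open>(t\<^sub>k\<^sub>+\<^sub>1 - t\<^sub>k) \<Sigma>\<^sub>i\<^sub>j\<close> plus the covariance of the drifts. The Riccati equation turns the
  boundary value problem into the representation \<open>\<mu>(s) = 2 \<V> (H(s) E(s) + \<integral> G(s,w) \<mu>(w) dw)\<close>, \<open>w\<close> from
  \<open>s\<close> to \<open>T\<close>, because the defect of this identity solves a homogeneous linear equation and vanishes at
  \<open>T\<close>; thus the covariance of the drifts is the excess term. Finally
  \<open>\<epsilon>\<^sub>N = (C\<^sub>i\<^sub>j - c\<^sub>i\<^sub>j) / sqrt (C\<^sub>i\<^sub>i C\<^sub>j\<^sub>j)\<close> with \<open>c\<^sub>i\<^sub>j\<close> the true covariance, and the strong law of large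
  numbers applies to products of increments, which are merely integrable.
\<close>

section \<open>The strong law of large numbers for integrable i.i.d. variables\<close>

text \<open>\<open>E\<close> and \<open>\<mu>\<close> are given separately for each
  \<open>\<omega>\<close>, with no measurability attached. Superposition supplies it: every drift
  quantity is a fixed linear form in the initial position, with coefficients taken from the
  solutions that start at unit vectors. A price increment is then one and the same measurable
  function of (initial position, path) on the reference space and, almost surely, on every day, so
  independence and equality of law pass from the pairs to the increments.

  The ordered exponential is prescribed only through its derivative in the first time, whereas the
  excess term integrates over the second. The factorisation
  \<open>\<Phi> s w = \<Phi> s T ** matrix_inv (\<Phi> w T)\<close> separates the two times; it
  yields continuity in \<open>w\<close> and reduces differentiation in \<open>s\<close> to a product
  rule.

  The strong law is obtained without truncation, by comparing the running maximum of the partial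
  sums with that of the shifted sequence, an argument that asks for first moments only.\<close>

primrec max_psum :: "nat \<Rightarrow> (nat \<Rightarrow> real) \<Rightarrow> real" where
  "max_psum 0 x = 0"
| "max_psum (Suc n) x = max 0 (x 0 + max_psum n (\<lambda>i. x (Suc i)))"

lemma max_psum_nonneg: "max_psum n x \<ge> 0"
  by (cases n) auto

text \<open>\<open>max_psum n x\<close> is the largest partial sum of length at most
  \<open>n\<close>, the empty sum included. Its recursion peels off the first term rather than the
  last, so that the shifted sequence appears on the right; the induction therefore varies
  \<open>x\<close>.\<close>

lemma sum_le_max_psum: "k \<le> n \<Longrightarrow> (\<Sum>i<k. x i) \<le> max_psum n x"
proof (induction n arbitrary: k x)
  case (Suc n)
  show ?case
  proof (cases k)
    case (Suc k')
    then have "(\<Sum>i<k'. x (Suc i)) \<le> max_psum n (\<lambda>i. x (Suc i))"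
      using Suc.IH[of k' "\<lambda>i. x (Suc i)"] Suc.prems by simp
    then show ?thesis
      using Suc by (simp add: sum.lessThan_Suc_shift del: sum.lessThan_Suc)
  qed (simp add: max_psum_nonneg)
qed simp

lemma max_psum_mono: "max_psum n x \<le> max_psum (Suc n) x"
proof (induction n arbitrary: x)
  case (Suc n)
  have "max_psum n (\<lambda>i. x (Suc i)) \<le> max_psum (Suc n) (\<lambda>i. x (Suc i))"
    by (rule Suc)
  then show ?case
    unfolding max_psum.simps(2)[of n x] max_psum.simps(2)[of "Suc n" x] by linarith
qed simp

text \<open>A crude bound, there to make running maxima of integrable variables integrable.\<close>

lemma max_psum_abs_le: "\<bar>max_psum n x\<bar> \<le> (\<Sum>i<n. \<bar>x i\<bar>)"
proof (induction n arbitrary: x)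
  case (Suc n)
  show ?case
    using Suc[of "\<lambda>i. x (Suc i)"] by (simp add: sum.lessThan_Suc_shift del: sum.lessThan_Suc)
qed simp

lemma max_psum_measurable [measurable]:
  "max_psum n \<in> borel_measurable (PiM UNIV (\<lambda>_. borel))"
proof (induction n)
  case (Suc n)
  have shift: "(\<lambda>x. (\<lambda>i. x (Suc i))) \<in> measurable (PiM UNIV (\<lambda>_. borel)) (PiM UNIV (\<lambda>_. borel :: real measure))"
    by (rule measurable_PiM_single') (auto simp: space_PiM)
  have [measurable]: "(\<lambda>x. x 0) \<in> borel_measurable (PiM UNIV (\<lambda>_::nat. borel :: real measure))"
    by (rule measurable_component_singleton) auto
  have [measurable]: "(\<lambda>x. max_psum n (\<lambda>i. x (Suc i))) \<in> borel_measurable (PiM UNIV (\<lambda>_. borel))"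
    using measurable_compose[OF shift Suc] .
  show ?case
    unfolding max_psum.simps by (intro borel_measurable_max borel_measurable_add) simp_all
qed simp

lemma sum_lessThan_add:
  fixes f :: "nat \<Rightarrow> 'b::comm_monoid_add"
  shows "(\<Sum>i<m + n. f i) = (\<Sum>i<m. f i) + (\<Sum>i<n. f (i + m))"
  by (induction n) (simp_all add: add_ac)

text \<open>Serves two relabellings: the shift of a sequence by one, and the renumbering of the days
  1, 2, ... from 0. Independence concerns finite families of events, and an injection carries a
  finite index set to a finite one without merging factors of the product.\<close>

lemma (in prob_space) indep_vars_reindex_inj:
  assumes "indep_vars M' X I" "inj_on f J" "f ` J \<subseteq> I"
  shows "indep_vars (\<lambda>j. M' (f j)) (\<lambda>j. X (f j)) J"
proof -
  let ?F = "\<lambda>i. {X i -` A \<inter> space M |A. A \<in> sets (M' i)}"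
  have F: "indep_sets ?F I" and X: "\<forall>i\<in>I. random_variable (M' i) (X i)"
    using assms(1) unfolding indep_vars_def2 by auto
  have "indep_sets (\<lambda>j. ?F (f j)) J"
  proof (rule indep_setsI)
    fix j assume "j \<in> J"
    then show "?F (f j) \<subseteq> events"
      using F assms(3) unfolding indep_sets_def by blast
  next
    fix A K assume K: "K \<noteq> {}" "K \<subseteq> J" "finite K" and A: "\<forall>j\<in>K. A j \<in> ?F (f j)"
    define B where "B = (\<lambda>i. A (inv_into J f i))"
    have B: "B (f j) = A j" if "j \<in> K" for j
      using that K assms(2) by (auto simp: B_def inv_into_f_f subset_iff)
    have inj: "inj_on f K"
      using K assms(2) inj_on_subset by blast
    have "prob (\<Inter>i\<in>f ` K. B i) = (\<Prod>i\<in>f ` K. prob (B i))"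
    proof (rule indep_setsD[OF F])
      show "f ` K \<subseteq> I" "f ` K \<noteq> {}" "finite (f ` K)"
        using K assms(3) by auto
      show "\<forall>i\<in>f ` K. B i \<in> ?F i"
        using A B by auto
    qed
    moreover have "(\<Inter>i\<in>f ` K. B i) = (\<Inter>j\<in>K. A j)"
      using B by auto
    moreover have "(\<Prod>i\<in>f ` K. prob (B i)) = (\<Prod>j\<in>K. prob (A j))"
      using B inj by (simp add: prod.reindex)
    ultimately show "prob (\<Inter>j\<in>K. A j) = (\<Prod>j\<in>K. prob (A j))"
      by simp
  qed
  then show ?thesis
    using X assms(3) unfolding indep_vars_def2 by auto
qed

section \<open>Independent identically distributed sequences: stationarity, zero-one law,
  averages\<close>

context prob_space begin

context
  fixes X :: "nat \<Rightarrow> 'a \<Rightarrow> real"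
  assumes ind: "indep_vars (\<lambda>_. borel) X UNIV"
    and ident: "\<And>n. distr M borel (X n) = distr M borel (X 0)"
    and int0: "integrable M (X 0)"
begin

lemma iid_measurable: "random_variable borel (X n)"
  using ind unfolding indep_vars_def by auto

lemma iid_integrable: "integrable M (X n)"
proof -
  note iid_measurable [measurable]
  have "integrable (distr M borel (X n)) (\<lambda>x. x)"
    unfolding ident[of n] using int0 by (subst integrable_distr_eq) auto
  then show ?thesis
    by (subst (asm) integrable_distr_eq) auto
qed

text \<open>Stationarity is required for the joint law, since the running maximum depends on many
  terms at once. By independence both laws are product measures, and their factors agree.\<close>

lemma iid_shift_distr:
  "distr M (PiM UNIV (\<lambda>_. borel)) (\<lambda>\<omega> i. X (Suc i) \<omega>) =
   distr M (PiM UNIV (\<lambda>_. borel)) (\<lambda>\<omega> i. X i \<omega>)"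
proof -
  note iid_measurable [measurable]
  have "indep_vars (\<lambda>_. borel) (\<lambda>i. X (Suc i)) UNIV"
    by (rule indep_vars_reindex_inj[OF ind]) auto
  then have "distr M (PiM UNIV (\<lambda>_. borel)) (\<lambda>\<omega> i. X (Suc i) \<omega>) = PiM UNIV (\<lambda>i. distr M borel (X (Suc i)))"
    using indep_vars_iff_distr_eq_PiM[where I=UNIV and M'="\<lambda>_. borel" and X="\<lambda>i. X (Suc i)"] by (simp add: restrict_UNIV)
  moreover have "distr M (PiM UNIV (\<lambda>_. borel)) (\<lambda>\<omega> i. X i \<omega>) = PiM UNIV (\<lambda>i. distr M borel (X i))"
    using indep_vars_iff_distr_eq_PiM[where I=UNIV and M'="\<lambda>_. borel" and X=X] ind by (simp add: restrict_UNIV)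
  moreover have "(\<lambda>i. distr M borel (X (Suc i))) = (\<lambda>i. distr M borel (X i))"
    by (rule ext, rule trans[OF ident ident[symmetric]])
  ultimately show ?thesis
    by simp
qed

text \<open>At each point, dropping the first \<open>m\<close> terms changes all longer partial sums
  by one and the same constant. The event therefore lies in every tail sigma-algebra, and
  Kolmogorov's law applies.\<close>

lemma bounded_psums_0_1:
  defines "B \<equiv> {\<omega> \<in> space M. \<exists>C. \<forall>n. (\<Sum>i<n. X i \<omega>) \<le> C}"
  shows "B \<in> events" "prob B = 0 \<or> prob B = 1"
proof -
  define A where "A = (\<lambda>i. sigma_sets (space M) {X i -` S \<inter> space M |S. S \<in> sets borel})"
  have sig: "sigma_algebra (space M) (A i)" for i
    unfolding A_def by (rule sigma_algebra_sigma_sets) auto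
  have inda: "indep_sets A UNIV"
    using ind unfolding indep_vars_def A_def by auto
  have Asp: "(\<Union> (A ` {m..})) \<subseteq> Pow (space M)" for m
    using sig unfolding sigma_algebra_iff2 by blast
  have tail: "B \<in> sigma_sets (space M) (\<Union> (A ` {m..}))" for m
  proof -
    define N where "N = sigma (space M) (\<Union> (A ` {m..}))"
    have spN: "space N = space M" and setsN: "sets N = sigma_sets (space M) (\<Union> (A ` {m..}))"
      unfolding N_def using Asp by (auto simp: space_measure_of_conv)
    have [measurable]: "X (i + m) \<in> borel_measurable N" for i
    proof (rule measurableI)
      fix S :: "real set" assume "S \<in> sets borel"
      then have "X (i + m) -` S \<inter> space M \<in> A (i + m)"
        unfolding A_def by blast
      then show "X (i + m) -` S \<inter> space N \<in> sets N"
        unfolding spN setsN by (intro sigma_sets.Basic) auto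
    qed auto
    \<comment> \<open>A bound ranging over the natural numbers turns the existential into a
      countable union, which keeps the event measurable.\<close>
    have "B = {\<omega> \<in> space N. \<exists>C::nat. \<forall>n. (\<Sum>i<n. X (i + m) \<omega>) \<le> real C}"
    proof -
      have "(\<exists>C. \<forall>n. (\<Sum>i<n. X i \<omega>) \<le> C) \<longleftrightarrow> (\<exists>C::nat. \<forall>n. (\<Sum>i<n. X (i + m) \<omega>) \<le> real C)" for \<omega>
      proof
        assume "\<exists>C. \<forall>n. (\<Sum>i<n. X i \<omega>) \<le> C"
        then obtain C where C: "\<And>n. (\<Sum>i<n. X i \<omega>) \<le> C" by blast
        obtain C' :: nat where C': "C - (\<Sum>i<m. X i \<omega>) \<le> real C'"
          using real_arch_simple by blast
        have "(\<Sum>i<n. X (i + m) \<omega>) \<le> real C'" for n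
          using C[of "m + n"] C' by (simp add: sum_lessThan_add)
        then show "\<exists>C::nat. \<forall>n. (\<Sum>i<n. X (i + m) \<omega>) \<le> real C" by blast
      next
        assume "\<exists>C::nat. \<forall>n. (\<Sum>i<n. X (i + m) \<omega>) \<le> real C"
        then obtain C where C: "\<And>n. (\<Sum>i<n. X (i + m) \<omega>) \<le> real C" by blast
        \<comment> \<open>The absolute values dominate both the head of a long sum and every sum
          shorter than \<open>m\<close>; in the latter case \<open>real C\<close> only adds
          something nonnegative.\<close>
        have "(\<Sum>i<n. X i \<omega>) \<le> (\<Sum>i<m. \<bar>X i \<omega>\<bar>) + real C" for n
        proof (cases "n \<le> m")
          case True
          have "(\<Sum>i<n. X i \<omega>) \<le> (\<Sum>i<n. \<bar>X i \<omega>\<bar>)"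
            by (intro sum_mono) simp
          also have "\<dots> \<le> (\<Sum>i<m. \<bar>X i \<omega>\<bar>)"
            using True by (intro sum_mono2) auto
          finally show ?thesis by simp
        next
          case False
          then obtain n' where "n = m + n'"
            by (metis nat_le_linear le_Suc_ex)
          moreover have "(\<Sum>i<m. X i \<omega>) \<le> (\<Sum>i<m. \<bar>X i \<omega>\<bar>)"
            by (intro sum_mono) simp
          ultimately show ?thesis
            using C[of n'] by (simp add: sum_lessThan_add)
        qed
        then show "\<exists>C. \<forall>n. (\<Sum>i<n. X i \<omega>) \<le> C"
          by blast
      qed
      then show ?thesis
        unfolding B_def spN by blast
    qed
    also have "\<dots> \<in> sets N"
      by measurable
    finally show ?thesis
      unfolding setsN .
  qed
  then have "B \<in> tail_events A"
    unfolding tail_events_def by blast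
  then show "prob B = 0 \<or> prob B = 1"
    by (rule kolmogorov_0_1_law[OF sig inda])
  show "B \<in> events"
    using \<open>B \<in> tail_events A\<close> tail_events_sets[of A] inda unfolding indep_sets_def by blast
qed

(* With m the running maximum of the partial sums shifted by one step, the running maximum is
   max 0 (X 0 + m), and stationarity gives E (max (- m) (X 0)) >= 0.  If m tended to infinity, the
   integrand would tend to X 0, which has negative mean. *)
lemma AE_psums_bounded_above:
  assumes neg: "expectation (X 0) < 0"
  shows "AE \<omega> in M. \<exists>C. \<forall>n. (\<Sum>i<n. X i \<omega>) \<le> C"
proof -
  note iid_measurable [measurable]
  define B where "B = {\<omega> \<in> space M. \<exists>C. \<forall>n. (\<Sum>i<n. X i \<omega>) \<le> C}"
  note B = bounded_psums_0_1[folded B_def]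
  \<comment> \<open>By the zero-one law it is enough to exclude probability 0.\<close>
  have "prob B \<noteq> 0"
  proof
    assume "prob B = 0"
    then have notB: "AE \<omega> in M. \<omega> \<notin> B"
      using B(1) by (simp add: prob_eq_0)
    define m where "m n \<omega> = max_psum n (\<lambda>i. X (Suc i) \<omega>)" for n \<omega>
    have [measurable]: "(\<lambda>\<omega> i. X i \<omega>) \<in> measurable M (PiM UNIV (\<lambda>_. borel))"
      "(\<lambda>\<omega> i. X (Suc i) \<omega>) \<in> measurable M (PiM UNIV (\<lambda>_. borel))"
      by (rule measurable_PiM_single'; auto)+
    have [measurable]: "m n \<in> borel_measurable M" for n
      unfolding m_def by measurable
    have int: "integrable M (\<lambda>\<omega>. max_psum n (\<lambda>i. X (f i) \<omega>))"
      if [measurable]: "(\<lambda>\<omega>. max_psum n (\<lambda>i. X (f i) \<omega>)) \<in> borel_measurable M" for n and f :: "nat \<Rightarrow> nat"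
    proof (rule Bochner_Integration.integrable_bound)
      show "integrable M (\<lambda>\<omega>. \<Sum>i<n. \<bar>X (f i) \<omega>\<bar>)"
        by (intro Bochner_Integration.integrable_sum integrable_abs iid_integrable)
      show "AE \<omega> in M. norm (max_psum n (\<lambda>i. X (f i) \<omega>)) \<le> norm (\<Sum>i<n. \<bar>X (f i) \<omega>\<bar>)"
        using max_psum_abs_le[of n] by (simp add: sum_nonneg)
    qed (fact that)
    have int1: "integrable M (\<lambda>\<omega>. max_psum n (\<lambda>i. X i \<omega>))" for n
      by (rule int) measurable
    have int2: "integrable M (m n)" for n
      unfolding m_def by (rule int) measurable
    have stat: "expectation (m n) = expectation (\<lambda>\<omega>. max_psum n (\<lambda>i. X i \<omega>))" for n
    proof -
      have "expectation (m n) = integral\<^sup>L (distr M (PiM UNIV (\<lambda>_. borel)) (\<lambda>\<omega> i. X (Suc i) \<omega>)) (max_psum n)"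
        unfolding m_def by (subst integral_distr) auto
      also have "\<dots> = expectation (\<lambda>\<omega>. max_psum n (\<lambda>i. X i \<omega>))"
        unfolding iid_shift_distr by (subst integral_distr) auto
      finally show ?thesis .
    qed
    have eq: "max (- m n \<omega>) (X 0 \<omega>) = max_psum (Suc n) (\<lambda>i. X i \<omega>) - m n \<omega>" for n \<omega>
      by (simp add: m_def)
    \<comment> \<open>By stationarity \<open>m n\<close> may be replaced under the expectation by
      the unshifted maximum of the same length; what remains is the expected growth of the running
      maximum in one step.\<close>
    have nonneg: "0 \<le> expectation (\<lambda>\<omega>. max (- m n \<omega>) (X 0 \<omega>))" for n
    proof -
      have "expectation (\<lambda>\<omega>. max_psum n (\<lambda>i. X i \<omega>)) \<le> expectation (\<lambda>\<omega>. max_psum (Suc n) (\<lambda>i. X i \<omega>))"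
        by (intro integral_mono int1 max_psum_mono)
      then show ?thesis
        unfolding eq using int1[of "Suc n"] int2[of n] stat[of n]
        by (subst Bochner_Integration.integral_diff) auto
    qed
    have "(\<lambda>n. expectation (\<lambda>\<omega>. max (- m n \<omega>) (X 0 \<omega>))) \<longlonglongrightarrow> expectation (X 0)"
    proof (rule integral_dominated_convergence[where w="\<lambda>\<omega>. \<bar>X 0 \<omega>\<bar>"])
      show "AE \<omega> in M. (\<lambda>n. max (- m n \<omega>) (X 0 \<omega>)) \<longlonglongrightarrow> X 0 \<omega>"
        using notB AE_space
      proof eventually_elim
        case (elim \<omega>)
        then have unb: "\<And>C. \<exists>n. (\<Sum>i<n. X i \<omega>) > C"
          unfolding B_def by (auto simp: not_le)
        obtain n where n: "(\<Sum>i<n. X i \<omega>) > \<bar>X 0 \<omega>\<bar> + \<bar>X 0 \<omega>\<bar>"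
          using unb by blast
        then obtain n' where n': "n = Suc n'"
          by (cases n) auto
        \<comment> \<open>The sum of length \<open>n\<close> exceeds twice
          \<open>\<bar>X 0 \<omega>\<bar>\<close>, so without its first term it still exceeds
          \<open>\<bar>X 0 \<omega>\<bar>\<close>. Hence \<open>- m k \<omega>\<close> lies below
          \<open>X 0 \<omega>\<close>.\<close>
        have "max (- m k \<omega>) (X 0 \<omega>) = X 0 \<omega>" if "k \<ge> n'" for k
        proof -
          have "(\<Sum>i<n'. X (Suc i) \<omega>) \<le> m k \<omega>"
            unfolding m_def using that by (rule sum_le_max_psum)
          then show ?thesis
            using n unfolding n' sum.lessThan_Suc_shift by linarith
        qed
        then have "eventually (\<lambda>k. max (- m k \<omega>) (X 0 \<omega>) = X 0 \<omega>) sequentially"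
          using eventually_sequentially by blast
        then show ?case
          by (rule tendsto_eventually)
      qed
      show "AE \<omega> in M. norm (max (- m n \<omega>) (X 0 \<omega>)) \<le> \<bar>X 0 \<omega>\<bar>" for n
      proof (rule AE_I2)
        fix \<omega>
        have "m n \<omega> \<ge> 0"
          by (simp add: m_def max_psum_nonneg)
        then show "norm (max (- m n \<omega>) (X 0 \<omega>)) \<le> \<bar>X 0 \<omega>\<bar>"
          by (simp add: max_def)
      qed
    qed (use int0 in auto)
    then have "0 \<le> expectation (X 0)"
      by (rule LIMSEQ_le_const) (use nonneg in auto)
    then show False
      using neg by simp
  qed
  then have "prob B = 1"
    using B(2) by simp
  then have "AE \<omega> in M. \<omega> \<in> B"
    using B(1) by (simp add: prob_eq_1)
  then show ?thesis
    by eventually_elim (simp add: B_def)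
qed

end

text \<open>Centring at \<open>c q\<close>, slightly above the mean, makes the mean negative, so the
  centred partial sums have an upper bound, which is negligible after division by \<open>n\<close>.
  Only countably many \<open>q\<close> occur, which leaves a single null set for all
  \<open>e\<close>.\<close>

lemma AE_averages_eventually_less:
  fixes X :: "nat \<Rightarrow> 'a \<Rightarrow> real"
  assumes ind: "indep_vars (\<lambda>_. borel) X UNIV"
    and ident: "\<And>n. distr M borel (X n) = distr M borel (X 0)"
    and int0: "integrable M (X 0)"
  shows "AE \<omega> in M. \<forall>e>0. eventually (\<lambda>n. (\<Sum>i<n. X i \<omega>) / real n < expectation (X 0) + e) sequentially"
proof -
  have [measurable]: "random_variable borel (X n)" for n
    using ind unfolding indep_vars_def by auto
  define c where "c q = expectation (X 0) + inverse (real (Suc q))" for q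
  have "AE \<omega> in M. \<exists>C. \<forall>n. (\<Sum>i<n. X i \<omega> - c q) \<le> C" for q
  proof (rule AE_psums_bounded_above)
    show "indep_vars (\<lambda>_. borel) (\<lambda>i \<omega>. X i \<omega> - c q) UNIV"
      by (rule indep_vars_compose2[OF ind]) auto
    have "distr M borel (\<lambda>\<omega>. X n \<omega> - c q) = distr (distr M borel (X n)) borel (\<lambda>x. x - c q)" for n
      by (subst distr_distr) (auto simp: comp_def)
    then show "distr M borel (\<lambda>\<omega>. X n \<omega> - c q) = distr M borel (\<lambda>\<omega>. X 0 \<omega> - c q)" for n
      by (simp only: ident[of n])
    show "integrable M (\<lambda>\<omega>. X 0 \<omega> - c q)"
      using int0 by simp
    show "expectation (\<lambda>\<omega>. X 0 \<omega> - c q) < 0"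
      using int0 by (simp add: prob_space c_def)
  qed
  then have "AE \<omega> in M. \<forall>q. \<exists>C. \<forall>n. (\<Sum>i<n. X i \<omega> - c q) \<le> C"
    by (simp add: AE_all_countable)
  then show ?thesis
  proof eventually_elim
    case (elim \<omega>)
    show ?case
    proof (intro allI impI)
      fix e :: real assume "e > 0"
      then obtain q where q: "inverse (real (Suc q)) < e / 2"
        using reals_Archimedean[of "e / 2"] by auto
      obtain C where C: "\<And>n. (\<Sum>i<n. X i \<omega> - c q) \<le> C"
        using elim by blast
      have "eventually (\<lambda>n. C / real n < e / 2) sequentially"
        using \<open>e > 0\<close> by real_asymp
      then show "eventually (\<lambda>n. (\<Sum>i<n. X i \<omega>) / real n < expectation (X 0) + e) sequentially"
        using eventually_gt_at_top[of 0]
      proof eventually_elim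
        case (elim n)
        have "(\<Sum>i<n. X i \<omega>) \<le> C + real n * c q"
          using C[of n] by (simp add: sum_subtractf)
        then have "(\<Sum>i<n. X i \<omega>) / real n \<le> C / real n + c q"
          using elim by (simp add: field_simps)
        then show ?case
          using elim q unfolding c_def by linarith
      qed
    qed
  qed
qed

text \<open>The one-sided estimate, applied to \<open>X\<close> and to \<open>- X\<close>, encloses
  the averages.\<close>

theorem strong_law_of_large_numbers:
  fixes X :: "nat \<Rightarrow> 'a \<Rightarrow> real"
  assumes ind: "indep_vars (\<lambda>_. borel) X UNIV"
    and ident: "\<And>n. distr M borel (X n) = distr M borel (X 0)"
    and int0: "integrable M (X 0)"
  shows "AE \<omega> in M. (\<lambda>n. (\<Sum>i<n. X i \<omega>) / real n) \<longlonglongrightarrow> expectation (X 0)"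
proof -
  have [measurable]: "random_variable borel (X n)" for n
    using ind unfolding indep_vars_def by auto
  have "distr M borel (\<lambda>\<omega>. - X n \<omega>) = distr (distr M borel (X n)) borel (\<lambda>x. - x)" for n
    by (subst distr_distr) (auto simp: comp_def)
  then have "distr M borel (\<lambda>\<omega>. - X n \<omega>) = distr M borel (\<lambda>\<omega>. - X 0 \<omega>)" for n
    by (simp only: ident[of n])
  then have "AE \<omega> in M. \<forall>e>0. eventually (\<lambda>n. (\<Sum>i<n. - X i \<omega>) / real n < expectation (\<lambda>\<omega>. - X 0 \<omega>) + e) sequentially"
    using int0 by (intro AE_averages_eventually_less indep_vars_compose2[OF ind]) auto
  with AE_averages_eventually_less[OF assms] show ?thesis
  proof eventually_elim
    case (elim \<omega>)
    show ?case
    proof (rule tendstoI)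
      fix e :: real assume "e > 0"
      from elim(1)[rule_format, OF this] elim(2)[rule_format, OF this]
      show "eventually (\<lambda>n. dist ((\<Sum>i<n. X i \<omega>) / real n) (expectation (X 0)) < e) sequentially"
      proof eventually_elim
        case (elim n)
        then show ?case
          by (simp add: dist_real_def sum_negf abs_less_iff)
      qed
    qed
  qed
qed

end


section \<open>Linear differential equations and the mean field system\<close>

lemma bounded_bilinear_matrix_vector_mult:
  "bounded_bilinear ((*v) :: real^'n^'m \<Rightarrow> real^'n \<Rightarrow> real^'m)"
  unfolding bilinear_conv_bounded_bilinear[symmetric] bilinear_def
  by (auto intro!: linearI simp: algebra_simps matrix_vector_mult_scaleR scaleR_matrix_vector_assoc)

lemma matrix_vector_mult_minus:
  fixes B :: "real^'n^'m"
  shows "(- B) *v x = - (B *v x)" "B *v (- x) = - (B *v x)"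
  using bounded_bilinear.minus_left[OF bounded_bilinear_matrix_vector_mult]
    bounded_bilinear.minus_right[OF bounded_bilinear_matrix_vector_mult] by blast+

lemma has_vector_derivative_matrix_vector_mult:
  fixes K :: "real \<Rightarrow> real^'n^'m"
  assumes "(K has_vector_derivative K') (at s within S)" "(x has_vector_derivative x') (at s within S)"
  shows "((\<lambda>s. K s *v x s) has_vector_derivative K s *v x' + K' *v x s) (at s within S)"
  by (rule bounded_bilinear.has_vector_derivative[OF bounded_bilinear_matrix_vector_mult assms])

lemma has_vector_derivative_matrix_vector_mult_const_left:
  assumes "(x has_vector_derivative x') (at s within S)"
  shows "((\<lambda>s. (B :: real^'n^'m) *v x s) has_vector_derivative B *v x') (at s within S)"
  using has_vector_derivative_matrix_vector_mult[OF has_vector_derivative_const assms] by simp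

lemma has_vector_derivative_matrix_vector_mult_const_right:
  fixes K :: "real \<Rightarrow> real^'n^'m"
  assumes "(K has_vector_derivative K') (at s within S)"
  shows "((\<lambda>s. K s *v v) has_vector_derivative K' *v v) (at s within S)"
  using has_vector_derivative_matrix_vector_mult[OF assms has_vector_derivative_const] by simp

lemma continuous_on_matrix_vector_mult:
  fixes K :: "'a::topological_space \<Rightarrow> real^'n^'m"
  assumes "continuous_on S K" "continuous_on S x"
  shows "continuous_on S (\<lambda>s. K s *v x s)"
  by (rule bounded_bilinear.continuous_on[OF bounded_bilinear_matrix_vector_mult assms])

lemma has_vector_derivative_imp_continuous_on:
  assumes "\<And>s. s \<in> S \<Longrightarrow> (x has_vector_derivative x' s) (at s within S)"
  shows "continuous_on S x"
  using assms has_vector_derivative_continuous continuous_on_eq_continuous_within by blast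

text \<open>A Gronwall argument for the squared norm of \<open>x\<close>. The zero \<open>c\<close>
  may lie anywhere in the interval, because the equation is later used both forwards and backwards
  in time.\<close>

lemma linear_ode_eq_zero:
  fixes K :: "real \<Rightarrow> real^'d^'d"
  assumes K: "continuous_on {a..b} K"
    and ode: "\<And>s. s \<in> {a..b} \<Longrightarrow> (x has_vector_derivative K s *v x s) (at s within {a..b})"
    and c: "c \<in> {a..b}" "x c = 0" and s: "s \<in> {a..b}"
  shows "x s = 0"
proof -
  obtain L where L: "\<And>u. u \<in> {a..b} \<Longrightarrow> \<bar>x u \<bullet> (K u *v x u)\<bar> \<le> L * (x u \<bullet> x u)"
  proof -
    obtain C where C: "\<And>(B::real^'d^'d) v. norm (B *v v) \<le> norm B * norm v * C" and "C \<ge> 0"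
      using bounded_bilinear.nonneg_bounded[OF bounded_bilinear_matrix_vector_mult] by blast
    have "bounded (K ` {a..b})"
      using K by (intro compact_imp_bounded compact_continuous_image) auto
    then obtain D where D: "\<And>u. u \<in> {a..b} \<Longrightarrow> norm (K u) \<le> D"
      unfolding bounded_iff by blast
    have "\<bar>x u \<bullet> (K u *v x u)\<bar> \<le> (D * C) * (x u \<bullet> x u)" if "u \<in> {a..b}" for u
    proof -
      have "\<bar>x u \<bullet> (K u *v x u)\<bar> \<le> norm (x u) * norm (K u *v x u)"
        by (rule Cauchy_Schwarz_ineq2)
      also have "\<dots> \<le> norm (x u) * (norm (K u) * norm (x u) * C)"
        by (intro mult_left_mono C) simp
      also have "\<dots> \<le> norm (x u) * (D * norm (x u) * C)"
        using D[OF that] \<open>C \<ge> 0\<close> by (intro mult_left_mono mult_right_mono) auto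
      finally show ?thesis
        by (simp add: power2_norm_eq_inner[symmetric] power2_eq_square mult_ac)
    qed
    then show ?thesis
      by (rule that)
  qed
  \<comment> \<open>The weight is kept general: \<open>p = - 2 * L\<close> makes the weighted
    squared norm nonincreasing, for times after \<open>c\<close>, and \<open>p = 2 * L\<close> makes
    it nondecreasing, for times before \<open>c\<close>.\<close>
  have der: "((\<lambda>u. exp (p * u) * (x u \<bullet> x u)) has_real_derivative
      exp (p * u) * (p * (x u \<bullet> x u) + 2 * (x u \<bullet> (K u *v x u)))) (at u within {a..b})"
    if "u \<in> {a..b}" for u p
  proof -
    have "((\<lambda>u. x u \<bullet> x u) has_real_derivative 2 * (x u \<bullet> (K u *v x u))) (at u within {a..b})"
      using bounded_bilinear.has_vector_derivative[OF bounded_bilinear_inner ode[OF that] ode[OF that]]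
      by (simp add: has_real_derivative_iff_has_vector_derivative inner_commute)
    then show ?thesis
      by (auto intro!: derivative_eq_intros simp: algebra_simps)
  qed
  have mvt: "\<exists>\<xi>\<in>{u<..<v}. exp (p * v) * (x v \<bullet> x v) - exp (p * u) * (x u \<bullet> x u) =
      exp (p * \<xi>) * (p * (x \<xi> \<bullet> x \<xi>) + 2 * (x \<xi> \<bullet> (K \<xi> *v x \<xi>))) * (v - u)"
    if "u < v" "u \<in> {a..b}" "v \<in> {a..b}" for u v p
    using that by (intro mvt_simple has_field_derivative_imp_has_derivative
        has_field_derivative_subset[OF der]) auto
  consider "s = c" | "c < s" | "s < c" by linarith
  then have "x s \<bullet> x s \<le> 0"
  proof cases
    case 2
    obtain \<xi> where \<xi>: "\<xi> \<in> {c<..<s}" and eq: "exp (- (2 * L) * s) * (x s \<bullet> x s) - exp (- (2 * L) * c) * (x c \<bullet> x c) =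
      exp (- (2 * L) * \<xi>) * (- (2 * L) * (x \<xi> \<bullet> x \<xi>) + 2 * (x \<xi> \<bullet> (K \<xi> *v x \<xi>))) * (s - c)"
      using mvt[OF 2 c(1) s] by blast
    have "- (2 * L) * (x \<xi> \<bullet> x \<xi>) + 2 * (x \<xi> \<bullet> (K \<xi> *v x \<xi>)) \<le> 0"
      using L[of \<xi>] \<xi> c s by auto
    then have "exp (- (2 * L) * \<xi>) * (- (2 * L) * (x \<xi> \<bullet> x \<xi>) + 2 * (x \<xi> \<bullet> (K \<xi> *v x \<xi>))) * (s - c) \<le> 0"
      using 2 by (intro mult_nonpos_nonneg mult_nonneg_nonpos) auto
    then have "exp (- (2 * L) * s) * (x s \<bullet> x s) \<le> 0"
      unfolding eq[symmetric] using c(2) by simp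
    then show ?thesis
      by (simp add: mult_le_0_iff del: inner_gt_zero_iff)
  next
    case 3
    obtain \<xi> where \<xi>: "\<xi> \<in> {s<..<c}" and eq: "exp ((2 * L) * c) * (x c \<bullet> x c) - exp ((2 * L) * s) * (x s \<bullet> x s) =
      exp ((2 * L) * \<xi>) * ((2 * L) * (x \<xi> \<bullet> x \<xi>) + 2 * (x \<xi> \<bullet> (K \<xi> *v x \<xi>))) * (c - s)"
      using mvt[OF 3 s c(1)] by blast
    have "(2 * L) * (x \<xi> \<bullet> x \<xi>) + 2 * (x \<xi> \<bullet> (K \<xi> *v x \<xi>)) \<ge> 0"
      using L[of \<xi>] \<xi> c s by auto
    then have "exp ((2 * L) * \<xi>) * ((2 * L) * (x \<xi> \<bullet> x \<xi>) + 2 * (x \<xi> \<bullet> (K \<xi> *v x \<xi>))) * (c - s) \<ge> 0"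
      using 3 by (intro mult_nonneg_nonneg) auto
    then have "exp ((2 * L) * s) * (x s \<bullet> x s) \<le> 0"
      unfolding eq[symmetric] using c(2) by simp
    then show ?thesis
      by (simp add: mult_le_0_iff del: inner_gt_zero_iff)
  qed (use c in simp)
  then show ?thesis
    using inner_ge_zero[of "x s"] by (simp add: antisym)
qed

section \<open>Continuity of the inverse of a matrix function\<close>

lemma matrix_inv_invertible:
  fixes B :: "real^'n^'n"
  assumes "invertible B"
  shows "B ** matrix_inv B = mat 1" "matrix_inv B ** B = mat 1"
  using assms someI_ex[of "\<lambda>B'. B ** B' = mat 1 \<and> B' ** B = mat 1"]
  unfolding invertible_def matrix_inv_def by auto

lemma continuous_on_det:
  fixes F :: "'a::topological_space \<Rightarrow> real^'n^'n"
  assumes "\<And>i j. continuous_on S (\<lambda>s. F s $ i $ j)"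
  shows "continuous_on S (\<lambda>s. det (F s))"
  unfolding det_def by (intro continuous_intros assms)

text \<open>\<open>matrix_inv\<close> is defined by choice, so continuity is read off from an
  explicit formula: by Cramer's rule each entry is a quotient of determinants with nonvanishing
  denominator.\<close>

lemma continuous_on_matrix_inv:
  fixes F :: "'a::topological_space \<Rightarrow> real^'n^'n"
  assumes F: "continuous_on S F" and inv: "\<And>s. s \<in> S \<Longrightarrow> invertible (F s)"
  shows "continuous_on S (\<lambda>s. matrix_inv (F s))"
proof -
  have cF: "continuous_on S (\<lambda>s. F s $ i $ j)" for i j
    by (intro continuous_intros F)
  define R where "R = (\<lambda>s i j. det (\<chi> i' j'. if j' = i then axis j 1 $ i' else F s $ i' $ j') / det (F s))"
  have "matrix_inv (F s) = (\<chi> i j. R s i j)" if "s \<in> S" for s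
  proof -
    have "matrix_inv (F s) $ i $ j = R s i j" for i j
    proof -
      have "F s *v (matrix_inv (F s) *v axis j 1) = axis j 1"
        using matrix_inv_invertible[OF inv[OF that]] by (simp add: matrix_vector_mul_assoc)
      then have "matrix_inv (F s) *v axis j 1 = (\<chi> i. R s i j)"
        using inv[OF that] by (subst (asm) cramer) (auto simp: R_def invertible_det_nz)
      then have "(matrix_inv (F s) *v axis j 1) $ i = R s i j"
        by simp
      then show ?thesis
        by (simp add: matrix_vector_mult_basis column_def)
    qed
    then show ?thesis
      by (simp add: vec_eq_iff)
  qed
  moreover have "continuous_on S (\<lambda>s. \<chi> i j. R s i j)"
  proof -
    have "continuous_on S (\<lambda>s. if j' = i then axis j 1 $ i' else F s $ i' $ j')" for i j i' j' :: 'n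
      by (cases "j' = i") (auto intro: cF continuous_on_const)
    then show ?thesis
      unfolding R_def using inv
      by (intro continuous_on_vec_lambda continuous_on_divide continuous_on_det)
        (auto simp: invertible_det_nz intro: cF)
  qed
  ultimately show ?thesis
    by (simp cong: continuous_on_cong)
qed

section \<open>The time-ordered exponential as a propagator\<close>

context
  fixes T :: real and K :: "real \<Rightarrow> real^'d^'d" and \<Phi> :: "real \<Rightarrow> real \<Rightarrow> real^'d^'d"
  assumes T: "0 \<le> T" and K: "continuous_on {0..T} K" and \<Phi>: "is_ordered_exponential T K \<Phi>"
begin

lemma ordered_exponential_solves:
  assumes "w \<in> {0..T}" "s \<in> {0..w}"
  shows "((\<lambda>s. \<Phi> s w *v v) has_vector_derivative - K s *v (\<Phi> s w *v v)) (at s within {0..w})"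
proof -
  have "((\<lambda>s. \<Phi> s w) has_vector_derivative - (K s ** \<Phi> s w)) (at s within {0..w})"
    using \<Phi> assms unfolding is_ordered_exponential_def by blast
  from has_vector_derivative_matrix_vector_mult_const_right[OF this, of v] show ?thesis
    by (simp add: matrix_vector_mul_assoc[symmetric] matrix_vector_mult_minus)
qed

text \<open>A vector annihilated at time \<open>w\<close> gives a solution vanishing at
  \<open>w\<close>, hence at \<open>T\<close>, where the propagator is the identity.\<close>

lemma ordered_exponential_invertible:
  assumes w: "w \<in> {0..T}"
  shows "invertible (\<Phi> w T)"
proof -
  have "inj ((*v) (\<Phi> w T))"
  proof (rule injI)
    fix v v' assume "\<Phi> w T *v v = \<Phi> w T *v v'"
    then have "\<Phi> w T *v (v - v') = 0"
      by (simp add: matrix_vector_mult_diff_distrib)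
    moreover have "T \<in> {0..T}"
      using T by simp
    ultimately have "\<Phi> T T *v (v - v') = 0"
      using K T by (intro linear_ode_eq_zero[of 0 T "\<lambda>s. - K s" "\<lambda>s. \<Phi> s T *v (v - v')" w T])
        (use w in \<open>auto intro!: continuous_intros ordered_exponential_solves\<close>)
    moreover have "\<Phi> T T = mat 1"
      using \<Phi> \<open>T \<in> {0..T}\<close> unfolding is_ordered_exponential_def by blast
    ultimately show "v = v'"
      by simp
  qed
  then show ?thesis
    unfolding invertible_left_inverse matrix_left_invertible_injective .
qed

text \<open>Both sides solve the same linear equation in \<open>s\<close> and agree at
  \<open>s = w\<close>. This is the source of all regularity in the second time, about which the
  definition of \<open>\<Phi>\<close> says nothing directly.\<close>

lemma ordered_exponential_factor:
  assumes w: "w \<in> {0..T}" and s: "s \<in> {0..w}"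
  shows "\<Phi> s w = \<Phi> s T ** matrix_inv (\<Phi> w T)"
proof -
  have "\<Phi> s w *v v = \<Phi> s T *v (matrix_inv (\<Phi> w T) *v v)" for v
  proof -
    define u where "u = matrix_inv (\<Phi> w T) *v v"
    have "\<Phi> s w *v v - \<Phi> s T *v u = 0"
    proof (rule linear_ode_eq_zero[of 0 w "\<lambda>s. - K s" "\<lambda>s. \<Phi> s w *v v - \<Phi> s T *v u" w s])
      show "continuous_on {0..w} (\<lambda>s. - K s)"
        using K w by (intro continuous_intros) (auto intro: continuous_on_subset)
      have "\<Phi> w w = mat 1"
        using \<Phi> w unfolding is_ordered_exponential_def by blast
      then show "\<Phi> w w *v v - \<Phi> w T *v u = 0"
        using matrix_inv_invertible(1)[OF ordered_exponential_invertible[OF w]]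
        by (simp add: u_def matrix_vector_mul_assoc)
      show "((\<lambda>s. \<Phi> s w *v v - \<Phi> s T *v u) has_vector_derivative
          - K r *v (\<Phi> r w *v v - \<Phi> r T *v u)) (at r within {0..w})" if "r \<in> {0..w}" for r
      proof -
        have "((\<lambda>s. \<Phi> s T *v u) has_vector_derivative - K r *v (\<Phi> r T *v u)) (at r within {0..w})"
          using w T that by (intro has_vector_derivative_within_subset[OF ordered_exponential_solves]) auto
        then show ?thesis
          using ordered_exponential_solves[OF w that, of v]
          by (auto intro!: derivative_eq_intros simp: matrix_vector_mult_diff_distrib)
      qed
    qed (use w s in auto)
    then show ?thesis
      by (simp add: u_def)
  qed
  then show ?thesis
    by (simp add: matrix_eq matrix_vector_mul_assoc)
qed

lemma continuous_on_ordered_exponential: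
  "continuous_on {0..T} (\<lambda>s. \<Phi> s T)" "continuous_on {0..T} (\<lambda>w. matrix_inv (\<Phi> w T))"
proof -
  have "T \<in> {0..T}"
    using T by simp
  then show "continuous_on {0..T} (\<lambda>s. \<Phi> s T)"
    using \<Phi> unfolding is_ordered_exponential_def
    by (intro has_vector_derivative_imp_continuous_on) blast
  then show "continuous_on {0..T} (\<lambda>w. matrix_inv (\<Phi> w T))"
    by (rule continuous_on_matrix_inv) (rule ordered_exponential_invertible)
qed

lemma ordered_exponential_integral:
  assumes f: "continuous_on {0..T} f" and s: "s \<in> {0..T}"
  shows "integral {s..T} (\<lambda>w. \<Phi> s w *v f w) =
    \<Phi> s T *v integral {s..T} (\<lambda>w. matrix_inv (\<Phi> w T) *v f w)"
proof -
  have "integral {s..T} (\<lambda>w. \<Phi> s w *v f w) =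
    integral {s..T} (\<lambda>w. \<Phi> s T *v (matrix_inv (\<Phi> w T) *v f w))"
  proof (rule integral_cong)
    fix w assume "w \<in> {s..T}"
    then have "\<Phi> s w = \<Phi> s T ** matrix_inv (\<Phi> w T)"
      using s by (intro ordered_exponential_factor) auto
    then show "\<Phi> s w *v f w = \<Phi> s T *v (matrix_inv (\<Phi> w T) *v f w)"
      by (simp only: matrix_vector_mul_assoc)
  qed
  also have "\<dots> = \<Phi> s T *v integral {s..T} (\<lambda>w. matrix_inv (\<Phi> w T) *v f w)"
  proof (rule integral_linear[unfolded comp_def])
    have "continuous_on {s..T} (\<lambda>w. matrix_inv (\<Phi> w T) *v f w)"
      using s by (intro continuous_on_subset[OF continuous_on_matrix_vector_mult[OF
              continuous_on_ordered_exponential(2) f]]) auto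
    then show "(\<lambda>w. matrix_inv (\<Phi> w T) *v f w) integrable_on {s..T}"
      by (rule integrable_continuous_real)
  qed simp
  finally show ?thesis .
qed

text \<open>Here \<open>s\<close> enters both the limit of integration and the integrand. After
  factorisation the integrand no longer contains \<open>s\<close>, so the fundamental theorem and
  the product rule suffice and no differentiation under the integral sign occurs.\<close>

lemma ordered_exponential_integral_derivative:
  assumes f: "continuous_on {0..T} f" and s: "s \<in> {0..T}"
  shows "((\<lambda>s. integral {s..T} (\<lambda>w. \<Phi> s w *v f w)) has_vector_derivative
    - K s *v integral {s..T} (\<lambda>w. \<Phi> s w *v f w) - f s) (at s within {0..T})"
proof -
  define y where "y s = integral {s..T} (\<lambda>w. matrix_inv (\<Phi> w T) *v f w)" for s
  have y: "(y has_vector_derivative - (matrix_inv (\<Phi> s T) *v f s)) (at s within {0..T})"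
    unfolding y_def
    by (intro integral_has_vector_derivative' s continuous_on_matrix_vector_mult
        continuous_on_ordered_exponential(2) f)
  have F: "((\<lambda>s. \<Phi> s T) has_vector_derivative - (K s ** \<Phi> s T)) (at s within {0..T})"
    using \<Phi> s T unfolding is_ordered_exponential_def by auto
  have "((\<lambda>s. \<Phi> s T *v y s) has_vector_derivative
      \<Phi> s T *v - (matrix_inv (\<Phi> s T) *v f s) + - (K s ** \<Phi> s T) *v y s) (at s within {0..T})"
    by (rule has_vector_derivative_matrix_vector_mult[OF F y])
  also have "\<Phi> s T *v - (matrix_inv (\<Phi> s T) *v f s) = - f s"
    using matrix_inv_invertible(1)[OF ordered_exponential_invertible[OF s]]
    by (simp add: matrix_vector_mul_assoc linear_neg[OF matrix_vector_mul_linear])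
  also have "- (K s ** \<Phi> s T) *v y s = - K s *v (\<Phi> s T *v y s)"
    by (simp add: matrix_vector_mul_assoc[symmetric] matrix_vector_mult_minus)
  finally have "((\<lambda>s. \<Phi> s T *v y s) has_vector_derivative - K s *v (\<Phi> s T *v y s) - f s) (at s within {0..T})"
    by simp
  then show ?thesis
    unfolding y_def ordered_exponential_integral[OF f s, symmetric]
    by (rule has_vector_derivative_transform[OF s, rotated]) (simp add: ordered_exponential_integral[OF f])
qed

end

text \<open>The Riccati equation is what decouples the boundary value problem. At \<open>T\<close>
  the integral is empty and \<open>H T = - 2 A\<close> turns the claim into the boundary
  condition.\<close>

lemma mean_field_representation:
  assumes T: "0 \<le> T" and H: "riccati_solution T \<V> A \<gamma> \<Sigma> H"
    and \<Phi>: "is_ordered_exponential T (\<lambda>s. 2 *\<^sub>R (H s ** \<V>)) \<Phi>"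
    and sol: "mean_field_solution T \<V> \<A> A \<gamma> \<Sigma> x E \<mu>" and s: "s \<in> {0..T}"
  shows "\<mu> s = 2 *\<^sub>R (\<V> *v (H s *v E s + integral {s..T} (\<lambda>w. \<Phi> s w *v (\<A> *v \<mu> w))))"
proof -
  have H': "\<And>r. r \<in> {0..T} \<Longrightarrow> (H has_vector_derivative
        (- 2) *\<^sub>R (H r ** \<V> ** H r) + \<gamma> *\<^sub>R \<Sigma>) (at r within {0..T})"
    and HT: "H T = (- 2) *\<^sub>R A"
    using H unfolding riccati_solution_def by auto
  have E': "\<And>r. r \<in> {0..T} \<Longrightarrow> (E has_vector_derivative \<mu> r) (at r within {0..T})"
    and \<mu>': "\<And>r. r \<in> {0..T} \<Longrightarrow> (\<mu> has_vector_derivative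
        (- 2) *\<^sub>R ((\<V> ** \<A>) *v \<mu> r) + (2 * \<gamma>) *\<^sub>R ((\<V> ** \<Sigma>) *v E r)) (at r within {0..T})"
    and \<mu>T: "\<mu> T + 4 *\<^sub>R ((\<V> ** A) *v E T) = 0"
    using sol unfolding mean_field_solution_def by auto
  have cH: "continuous_on {0..T} H" and c\<mu>: "continuous_on {0..T} \<mu>"
    by (rule has_vector_derivative_imp_continuous_on; fact H' \<mu>')+
  have cHV: "continuous_on {0..T} (\<lambda>s. H s ** \<V>)" "continuous_on {0..T} (\<lambda>s. \<V> ** H s)"
    unfolding matrix_matrix_mult_def by (intro continuous_intros cH)+
  define Z where "Z s = integral {s..T} (\<lambda>w. \<Phi> s w *v (\<A> *v \<mu> w))" for s
  have Z': "(Z has_vector_derivative - (2 *\<^sub>R (H r ** \<V>)) *v Z r - \<A> *v \<mu> r) (at r within {0..T})"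
    if "r \<in> {0..T}" for r
    unfolding Z_def
    by (intro ordered_exponential_integral_derivative[OF T _ \<Phi>] continuous_intros cHV
        continuous_on_matrix_vector_mult c\<mu> that)
  define D where "D s = \<mu> s - 2 *\<^sub>R (\<V> *v (H s *v E s + Z s))" for s
  have "D s = 0"
  proof (rule linear_ode_eq_zero[of 0 T "\<lambda>s. (- 2) *\<^sub>R (\<V> ** H s)" D T s])
    show "continuous_on {0..T} (\<lambda>s. (- 2) *\<^sub>R (\<V> ** H s))"
      by (intro continuous_intros cHV)
    show "D T = 0"
      using \<mu>T unfolding D_def Z_def HT
      by (simp add: matrix_vector_mul_assoc[symmetric] scaleR_matrix_vector_assoc[symmetric]
          matrix_vector_mult_scaleR matrix_vector_mult_minus)
    show "(D has_vector_derivative ((- 2) *\<^sub>R (\<V> ** H r)) *v D r) (at r within {0..T})"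
      if r: "r \<in> {0..T}" for r
    proof -
      let ?d = "((- 2) *\<^sub>R ((\<V> ** \<A>) *v \<mu> r) + (2 * \<gamma>) *\<^sub>R ((\<V> ** \<Sigma>) *v E r)) -
        2 *\<^sub>R (\<V> *v ((H r *v \<mu> r + ((- 2) *\<^sub>R (H r ** \<V> ** H r) + \<gamma> *\<^sub>R \<Sigma>) *v E r) +
          (- (2 *\<^sub>R (H r ** \<V>)) *v Z r - \<A> *v \<mu> r)))"
      have "(D has_vector_derivative ?d) (at r within {0..T})"
        unfolding D_def
        by (intro has_vector_derivative_diff has_vector_derivative_add \<mu>' E' H' Z' r
            bounded_linear.has_vector_derivative[OF bounded_linear_scaleR_right]
            has_vector_derivative_matrix_vector_mult_const_left has_vector_derivative_matrix_vector_mult)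
      \<comment> \<open>The terms in \<open>\<gamma>\<close> and those in
        \<open>\<A> *v \<mu> r\<close> cancel. The quadratic Riccati term and the derivative of
        \<open>Z\<close> both carry a left factor \<open>\<V> ** H r\<close>, as does the remaining
        term in \<open>\<mu> r\<close>; together they rebuild \<open>D r\<close>.\<close>
      also have "?d = ((- 2) *\<^sub>R (\<V> ** H r)) *v D r"
        unfolding D_def
        by (simp add: matrix_vector_mul_assoc[symmetric] scaleR_matrix_vector_assoc[symmetric]
            matrix_vector_mult_scaleR matrix_vector_mult_minus algebra_simps)
      finally show ?thesis .
    qed
  qed (use T s in auto)
  then show ?thesis
    unfolding D_def Z_def by simp
qed

text \<open>The problem is linear, so combinations of the solutions from unit vectors solve it
  again; uniqueness identifies them with any given solution.\<close>

lemma mean_field_solution_superposition: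
  assumes uniq: "mean_field_uniquely_solvable T \<V> \<A> A \<gamma> \<Sigma>"
  shows "\<exists>EB \<mu>B. (\<forall>b. mean_field_solution T \<V> \<A> A \<gamma> \<Sigma> (axis b 1) (EB b) (\<mu>B b)) \<and>
    (\<forall>x E \<mu> s. mean_field_solution T \<V> \<A> A \<gamma> \<Sigma> x E \<mu> \<longrightarrow> s \<in> {0..T} \<longrightarrow>
       E s = (\<Sum>b\<in>UNIV. x $ b *\<^sub>R EB b s) \<and> \<mu> s = (\<Sum>b\<in>UNIV. x $ b *\<^sub>R \<mu>B b s))"
proof -
  have "\<exists>E \<mu>. mean_field_solution T \<V> \<A> A \<gamma> \<Sigma> (axis b 1) E \<mu>" for b
    using uniq unfolding mean_field_uniquely_solvable_def by blast
  then obtain EB \<mu>B where B: "\<And>b. mean_field_solution T \<V> \<A> A \<gamma> \<Sigma> (axis b 1) (EB b) (\<mu>B b)"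
    by metis
  have E': "\<And>b r. r \<in> {0..T} \<Longrightarrow> (EB b has_vector_derivative \<mu>B b r) (at r within {0..T})"
    and \<mu>': "\<And>b r. r \<in> {0..T} \<Longrightarrow> (\<mu>B b has_vector_derivative
        (- 2) *\<^sub>R ((\<V> ** \<A>) *v \<mu>B b r) + (2 * \<gamma>) *\<^sub>R ((\<V> ** \<Sigma>) *v EB b r)) (at r within {0..T})"
    and E0: "\<And>b. EB b 0 = axis b 1"
    and "\<And>b. \<mu>B b T + 4 *\<^sub>R ((\<V> ** A) *v EB b T) = 0"
    using B unfolding mean_field_solution_def by blast+
  then have \<mu>T: "\<mu>B b T = - (4 *\<^sub>R ((\<V> ** A) *v EB b T))" for b
    by (metis add_eq_0_iff2)
  have "mean_field_solution T \<V> \<A> A \<gamma> \<Sigma> x (\<lambda>s. \<Sum>b\<in>UNIV. x $ b *\<^sub>R EB b s) (\<lambda>s. \<Sum>b\<in>UNIV. x $ b *\<^sub>R \<mu>B b s)"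
    for x
    unfolding mean_field_solution_def
  proof (intro conjI ballI)
    fix s assume s: "s \<in> {0..T}"
    show "((\<lambda>s. \<Sum>b\<in>UNIV. x $ b *\<^sub>R EB b s) has_vector_derivative (\<Sum>b\<in>UNIV. x $ b *\<^sub>R \<mu>B b s)) (at s within {0..T})"
      by (intro has_vector_derivative_sum E' s
          bounded_linear.has_vector_derivative[OF bounded_linear_scaleR_right])
    have "((\<lambda>s. \<Sum>b\<in>UNIV. x $ b *\<^sub>R \<mu>B b s) has_vector_derivative (\<Sum>b\<in>UNIV. x $ b *\<^sub>R
        ((- 2) *\<^sub>R ((\<V> ** \<A>) *v \<mu>B b s) + (2 * \<gamma>) *\<^sub>R ((\<V> ** \<Sigma>) *v EB b s)))) (at s within {0..T})"
      by (intro has_vector_derivative_sum \<mu>' s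
          bounded_linear.has_vector_derivative[OF bounded_linear_scaleR_right])
    also have "(\<Sum>b\<in>UNIV. x $ b *\<^sub>R
        ((- 2) *\<^sub>R ((\<V> ** \<A>) *v \<mu>B b s) + (2 * \<gamma>) *\<^sub>R ((\<V> ** \<Sigma>) *v EB b s))) =
        (- 2) *\<^sub>R ((\<V> ** \<A>) *v (\<Sum>b\<in>UNIV. x $ b *\<^sub>R \<mu>B b s)) +
        (2 * \<gamma>) *\<^sub>R ((\<V> ** \<Sigma>) *v (\<Sum>b\<in>UNIV. x $ b *\<^sub>R EB b s))"
      by (simp add: linear_sum[OF matrix_vector_mul_linear] matrix_vector_mult_scaleR scaleR_sum_right
          sum.distrib sum_subtractf sum_negf scaleR_add_right scaleR_diff_right mult_ac)
    finally show "((\<lambda>s. \<Sum>b\<in>UNIV. x $ b *\<^sub>R \<mu>B b s) has_vector_derivative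
        (- 2) *\<^sub>R ((\<V> ** \<A>) *v (\<Sum>b\<in>UNIV. x $ b *\<^sub>R \<mu>B b s)) +
        (2 * \<gamma>) *\<^sub>R ((\<V> ** \<Sigma>) *v (\<Sum>b\<in>UNIV. x $ b *\<^sub>R EB b s))) (at s within {0..T})" .
  next
    show "(\<Sum>b\<in>UNIV. x $ b *\<^sub>R EB b 0) = x"
      unfolding E0 by (simp add: vec_eq_iff axis_def if_distrib cong: if_cong)
    show "(\<Sum>b\<in>UNIV. x $ b *\<^sub>R \<mu>B b T) + 4 *\<^sub>R (\<V> ** A *v (\<Sum>b\<in>UNIV. x $ b *\<^sub>R EB b T)) = 0"
      unfolding \<mu>T by (simp add: linear_sum[OF matrix_vector_mul_linear] matrix_vector_mult_scaleR
          scaleR_sum_right sum_negf mult_ac)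
  qed
  note sum = this
  have "E s = (\<Sum>b\<in>UNIV. x $ b *\<^sub>R EB b s) \<and> \<mu> s = (\<Sum>b\<in>UNIV. x $ b *\<^sub>R \<mu>B b s)"
    if sol: "mean_field_solution T \<V> \<A> A \<gamma> \<Sigma> x E \<mu>" and s: "s \<in> {0..T}" for x E \<mu> s
  proof -
    obtain E' \<mu>' where "\<And>F \<nu>. mean_field_solution T \<V> \<A> A \<gamma> \<Sigma> x F \<nu> \<Longrightarrow> F s = E' s \<and> \<nu> s = \<mu>' s"
      using uniq s unfolding mean_field_uniquely_solvable_def by blast
    from this[OF sol] this[OF sum] show ?thesis
      by simp
  qed
  with B show ?thesis
    by blast
qed

lemma mean_field_solution_continuous:
  assumes "mean_field_solution T \<V> \<A> A \<gamma> \<Sigma> x E \<mu>"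
  shows "continuous_on {0..T} E" "continuous_on {0..T} \<mu>"
  using assms unfolding mean_field_solution_def
  by (auto intro!: has_vector_derivative_imp_continuous_on)

section \<open>The kernel terms in coordinates and their linear dependence on the initial
  position\<close>

lemma diag_mat_vector_mult: "(diag_mat c *v x) $ n = c n * x $ n"
proof -
  have "(diag_mat c *v x) $ n = (\<Sum>l\<in>UNIV. if n = l then c n * x $ l else 0)"
    unfolding diag_mat_def matrix_vector_mult_def vec_lambda_beta by (intro sum.cong refl) simp
  then show ?thesis
    by simp
qed

lemma matrix_mult_diag_mat: "(B ** diag_mat c) $ n $ l = B $ n $ l * c l"
proof -
  have "(B ** diag_mat c) $ n $ l = (\<Sum>m\<in>UNIV. if m = l then B $ n $ l * c l else 0)"
    unfolding diag_mat_def matrix_matrix_mult_def vec_lambda_beta by (intro sum.cong refl) simp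
  then show ?thesis
    by simp
qed

context
  fixes T :: real and K :: "real \<Rightarrow> real^'d^'d" and \<Phi> :: "real \<Rightarrow> real \<Rightarrow> real^'d^'d"
    and \<alpha> :: "'d \<Rightarrow> real" and G :: "real \<Rightarrow> real \<Rightarrow> real^'d^'d"
  assumes T: "0 \<le> T" and K: "continuous_on {0..T} K" and \<Phi>: "is_ordered_exponential T K \<Phi>"
    and G: "\<And>s w. G s w = \<Phi> s w ** diag_mat \<alpha>"
begin

lemma kernel_integrable:
  assumes \<mu>: "continuous_on {0..T} (\<mu> :: real \<Rightarrow> real^'d)" and s: "s \<in> {0..T}"
  shows "(\<lambda>w. G s w $ n $ l * \<mu> w $ l) integrable_on {s..T}"
proof -
  have "continuous_on {s..T} (\<lambda>w. (\<Phi> s T ** matrix_inv (\<Phi> w T)) $ n $ l * \<alpha> l * \<mu> w $ l)"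
    using s unfolding matrix_matrix_mult_def
    by (auto intro!: continuous_intros continuous_on_subset[OF continuous_on_ordered_exponential(2)[OF T K \<Phi>]]
        continuous_on_subset[OF \<mu>])
  then have "(\<lambda>w. (\<Phi> s T ** matrix_inv (\<Phi> w T)) $ n $ l * \<alpha> l * \<mu> w $ l) integrable_on {s..T}"
    by (rule integrable_continuous_real)
  then show ?thesis
  proof (rule integrable_eq)
    fix w assume "w \<in> {s..T}"
    then have "\<Phi> s w = \<Phi> s T ** matrix_inv (\<Phi> w T)"
      using s by (intro ordered_exponential_factor[OF T K \<Phi>]) auto
    then show "(\<Phi> s T ** matrix_inv (\<Phi> w T)) $ n $ l * \<alpha> l * \<mu> w $ l = G s w $ n $ l * \<mu> w $ l"
      by (simp only: G matrix_mult_diag_mat)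
  qed
qed

text \<open>Factorisation writes the integral as a finite sum of products: an entry of
  \<open>\<Phi> s T\<close> times an integral whose integrand is free of \<open>s\<close>. Each
  factor is continuous in \<open>s\<close>.\<close>

lemma kernel_integral_continuous:
  assumes \<mu>: "continuous_on {0..T} (\<mu> :: real \<Rightarrow> real^'d)"
  shows "continuous_on {0..T} (\<lambda>s. integral {s..T} (\<lambda>w. G s w $ n $ l * \<mu> w $ l))"
proof -
  define y where "y m s = integral {s..T} (\<lambda>w. matrix_inv (\<Phi> w T) $ m $ l * \<alpha> l * \<mu> w $ l)" for m s
  have c: "continuous_on {0..T} (\<lambda>w. matrix_inv (\<Phi> w T) $ m $ l * \<alpha> l * \<mu> w $ l)" for m
    by (intro continuous_intros continuous_on_ordered_exponential(2)[OF T K \<Phi>] \<mu>)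
  have "integral {s..T} (\<lambda>w. G s w $ n $ l * \<mu> w $ l) = (\<Sum>m\<in>UNIV. \<Phi> s T $ n $ m * y m s)"
    if s: "s \<in> {0..T}" for s
  proof -
    have "integral {s..T} (\<lambda>w. G s w $ n $ l * \<mu> w $ l) =
        integral {s..T} (\<lambda>w. \<Sum>m\<in>UNIV. \<Phi> s T $ n $ m * (matrix_inv (\<Phi> w T) $ m $ l * \<alpha> l * \<mu> w $ l))"
    proof (rule integral_cong)
      fix w assume "w \<in> {s..T}"
      then have "\<Phi> s w = \<Phi> s T ** matrix_inv (\<Phi> w T)"
        using s by (intro ordered_exponential_factor[OF T K \<Phi>]) auto
      then have "G s w $ n $ l = (\<Sum>m\<in>UNIV. \<Phi> s T $ n $ m * matrix_inv (\<Phi> w T) $ m $ l) * \<alpha> l"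
        by (simp only: G matrix_mult_diag_mat) (simp add: matrix_matrix_mult_def)
      then show "G s w $ n $ l * \<mu> w $ l =
          (\<Sum>m\<in>UNIV. \<Phi> s T $ n $ m * (matrix_inv (\<Phi> w T) $ m $ l * \<alpha> l * \<mu> w $ l))"
        by (simp add: sum_distrib_left sum_distrib_right mult_ac)
    qed
    also have "\<dots> = (\<Sum>m\<in>UNIV. \<Phi> s T $ n $ m * y m s)"
      unfolding y_def integral_mult_right[symmetric] using s
      by (intro integral_sum integrable_continuous_real continuous_intros continuous_on_subset[OF c]) auto
    finally show ?thesis .
  qed
  note eq = this
  have "continuous_on {0..T} (y m)" for m
    unfolding y_def
    by (rule has_vector_derivative_imp_continuous_on, rule integral_has_vector_derivative'[OF c])
  then have "continuous_on {0..T} (\<lambda>s. \<Sum>m\<in>UNIV. \<Phi> s T $ n $ m * y m s)"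
    by (intro continuous_intros continuous_on_ordered_exponential(1)[OF T K \<Phi>])
  then show ?thesis
    by (rule continuous_on_eq) (rule eq[symmetric])
qed

lemma theta_term_superposition:
  fixes t :: "nat \<Rightarrow> real"
  assumes t: "0 \<le> t k" "t (k + 1) \<le> T"
    and m: "\<And>b. continuous_on {0..T} (m b)"
    and \<mu>: "\<And>w. w \<in> {0..T} \<Longrightarrow> \<mu> w = (\<Sum>b\<in>UNIV. x $ b *\<^sub>R m b w)"
  shows "theta_term t T G k n l \<mu> = (\<Sum>b\<in>UNIV. x $ b * theta_term t T G k n l (m b))"
proof -
  have inner: "integral {s..T} (\<lambda>w. G s w $ n $ l * \<mu> w $ l) =
      (\<Sum>b\<in>UNIV. x $ b * integral {s..T} (\<lambda>w. G s w $ n $ l * m b w $ l))" if s: "s \<in> {0..T}" for s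
  proof -
    have "integral {s..T} (\<lambda>w. G s w $ n $ l * \<mu> w $ l) =
        integral {s..T} (\<lambda>w. \<Sum>b\<in>UNIV. x $ b * (G s w $ n $ l * m b w $ l))"
      using s by (intro integral_cong) (auto simp: \<mu> sum_distrib_left mult_ac)
    also have "\<dots> = (\<Sum>b\<in>UNIV. x $ b * integral {s..T} (\<lambda>w. G s w $ n $ l * m b w $ l))"
      unfolding integral_mult_right[symmetric]
      by (intro integral_sum integrable_on_mult_right kernel_integrable m s) simp
    finally show ?thesis .
  qed
  have "theta_term t T G k n l \<mu> = integral {t k..t (k + 1)}
      (\<lambda>s. \<Sum>b\<in>UNIV. x $ b * integral {s..T} (\<lambda>w. G s w $ n $ l * m b w $ l))"
    unfolding theta_term_def using t by (intro integral_cong inner) auto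
  also have "\<dots> = (\<Sum>b\<in>UNIV. integral {t k..t (k + 1)}
      (\<lambda>s. x $ b * integral {s..T} (\<lambda>w. G s w $ n $ l * m b w $ l)))"
  proof (rule integral_sum)
    fix b
    have "continuous_on {t k..t (k + 1)} (\<lambda>s. integral {s..T} (\<lambda>w. G s w $ n $ l * m b w $ l))"
      using t by (intro continuous_on_subset[OF kernel_integral_continuous[OF m]]) auto
    then show "(\<lambda>s. x $ b * integral {s..T} (\<lambda>w. G s w $ n $ l * m b w $ l)) integrable_on {t k..t (k + 1)}"
      by (intro integrable_on_mult_right integrable_continuous_real)
  qed simp
  also have "\<dots> = (\<Sum>b\<in>UNIV. x $ b * theta_term t T G k n l (m b))"
    unfolding theta_term_def integral_mult_right ..
  finally show ?thesis .
qed

end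

lemma pi_term_superposition:
  fixes t :: "nat \<Rightarrow> real" and H :: "real \<Rightarrow> real^'d^'d"
  assumes t: "0 \<le> t k" "t (k + 1) \<le> T" and H: "continuous_on {0..T} H"
    and m: "\<And>b. continuous_on {0..T} (m b)"
    and E: "\<And>w. w \<in> {0..T} \<Longrightarrow> E w = (\<Sum>b\<in>UNIV. x $ b *\<^sub>R m b w)"
  shows "pi_term t H k n l E = (\<Sum>b\<in>UNIV. x $ b * pi_term t H k n l (m b))"
proof -
  have "pi_term t H k n l E = integral {t k..t (k + 1)} (\<lambda>s. \<Sum>b\<in>UNIV. x $ b * (H s $ n $ l * m b s $ l))"
    unfolding pi_term_def using t by (intro integral_cong) (auto simp: E sum_distrib_left mult_ac)
  also have "\<dots> = (\<Sum>b\<in>UNIV. x $ b * pi_term t H k n l (m b))"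
    unfolding pi_term_def integral_mult_right[symmetric] using t
    by (intro integral_sum integrable_continuous_real continuous_intros)
      (auto intro: continuous_on_subset[OF H] continuous_on_subset[OF m])
  finally show ?thesis .
qed

text \<open>The factor \<open>V n / (2 * \<eta> n)\<close> is the diagonal entry of
  \<open>2 VV\<close> in the representation of \<open>\<mu>\<close>; its product over two assets
  later becomes the constant in \<open>B_coeff\<close>.\<close>

lemma mean_field_drift_decomposition:
  fixes t :: "nat \<Rightarrow> real" and H :: "real \<Rightarrow> real^'d^'d"
  assumes T: "0 \<le> T" and H: "riccati_solution T (VV V \<eta>) A \<gamma> \<Sigma> H"
    and \<Phi>: "is_ordered_exponential T (\<lambda>s. 2 *\<^sub>R (H s ** VV V \<eta>)) \<Phi>"
    and G: "\<And>s w. G s w = \<Phi> s w ** diag_mat \<alpha>"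
    and sol: "mean_field_solution T (VV V \<eta>) (diag_mat \<alpha>) A \<gamma> \<Sigma> x E \<mu>"
    and t: "0 \<le> t k" "t (k + 1) \<le> T"
  shows "integral {t k..t (k + 1)} (\<lambda>s. \<mu> s $ n) =
    V n / (2 * \<eta> n) * (\<Sum>l\<in>UNIV. pi_term t H k n l E + theta_term t T G k n l \<mu>)"
proof -
  note c = mean_field_solution_continuous[OF sol]
  have cH: "continuous_on {0..T} H"
    using H unfolding riccati_solution_def by (auto intro!: has_vector_derivative_imp_continuous_on)
  have K: "continuous_on {0..T} (\<lambda>s. 2 *\<^sub>R (H s ** VV V \<eta>))"
    unfolding matrix_matrix_mult_def by (intro continuous_intros cH)
  note ker = kernel_integrable[OF T K \<Phi> G c(2)] kernel_integral_continuous[OF T K \<Phi> G c(2)]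
  have \<mu>n: "\<mu> s $ n = V n / (2 * \<eta> n) * (\<Sum>l\<in>UNIV. H s $ n $ l * E s $ l +
      integral {s..T} (\<lambda>w. G s w $ n $ l * \<mu> w $ l))" if s: "s \<in> {0..T}" for s
  proof -
    define f where "f w = \<Phi> s w *v (diag_mat \<alpha> *v \<mu> w)" for w
    have f: "f w $ m = (\<Sum>l\<in>UNIV. G s w $ m $ l * \<mu> w $ l)" for w m
      by (simp add: f_def G matrix_vector_mul_assoc) (simp add: matrix_vector_mult_def)
    have int: "(\<lambda>w. f w $ m) integrable_on {s..T}" for m
      unfolding f by (intro integrable_sum ker(1) s) simp
    \<comment> \<open>The representation contains a vector-valued integral and the excess term
      scalar ones; integrability of the vector function allows coordinates to be taken
      inside.\<close>
    have "f integrable_on {s..T}"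
      by (subst integrable_componentwise_iff) (use int in \<open>auto simp: Basis_vec_def inner_axis\<close>)
    then have "integral {s..T} f $ n = integral {s..T} (\<lambda>w. f w $ n)"
      by simp
    also have "\<dots> = (\<Sum>l\<in>UNIV. integral {s..T} (\<lambda>w. G s w $ n $ l * \<mu> w $ l))"
      unfolding f by (intro integral_sum ker(1) s) simp
    finally show ?thesis
      using mean_field_representation[OF T H \<Phi> sol s]
      by (simp add: f_def[symmetric, abs_def] VV_def diag_mat_vector_mult sum.distrib)
        (simp add: matrix_vector_mult_def)
  qed
  have "integral {t k..t (k + 1)} (\<lambda>s. \<mu> s $ n) = integral {t k..t (k + 1)} (\<lambda>s. V n / (2 * \<eta> n) *
      (\<Sum>l\<in>UNIV. H s $ n $ l * E s $ l + integral {s..T} (\<lambda>w. G s w $ n $ l * \<mu> w $ l)))"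
    using t by (intro integral_cong \<mu>n) auto
  also have "\<dots> = V n / (2 * \<eta> n) * (\<Sum>l\<in>UNIV. pi_term t H k n l E + theta_term t T G k n l \<mu>)"
  proof -
    have i1: "(\<lambda>s. H s $ n $ l * E s $ l) integrable_on {t k..t (k + 1)}" for l
      using t by (intro integrable_continuous_real continuous_intros continuous_on_subset[OF cH]
          continuous_on_subset[OF c(1)]) auto
    have i2: "(\<lambda>s. integral {s..T} (\<lambda>w. G s w $ n $ l * \<mu> w $ l)) integrable_on {t k..t (k + 1)}" for l
      using t by (intro integrable_continuous_real continuous_on_subset[OF ker(2)]) auto
    show ?thesis
      unfolding integral_mult_right pi_term_def theta_term_def integral_add[OF i1 i2, symmetric]
      by (subst integral_sum) (auto intro: integrable_add[OF i1 i2, simplified])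
  qed
  finally show ?thesis .
qed


section \<open>Covariances of square-integrable variables and Wiener increments\<close>

text \<open>Measurability is a separate clause because the square forgets the sign, so its
  integrability does not make \<open>X\<close> measurable.\<close>

definition square_integrable :: "'a measure \<Rightarrow> ('a \<Rightarrow> real) \<Rightarrow> bool" where
  "square_integrable M X \<longleftrightarrow> X \<in> borel_measurable M \<and> integrable M (\<lambda>\<omega>. (X \<omega>)\<^sup>2)"

lemma square_integrable_measurable: "square_integrable M X \<Longrightarrow> X \<in> borel_measurable M"
  by (simp add: square_integrable_def)

lemma square_integrable_mult:
  assumes X: "square_integrable M X" and Y: "square_integrable M Y"
  shows "integrable M (\<lambda>\<omega>. X \<omega> * Y \<omega>)"
proof (rule Bochner_Integration.integrable_bound)
  show "integrable M (\<lambda>\<omega>. (X \<omega>)\<^sup>2 + (Y \<omega>)\<^sup>2)"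
    using X Y by (simp add: square_integrable_def)
  show "(\<lambda>\<omega>. X \<omega> * Y \<omega>) \<in> borel_measurable M"
    using X Y by (intro borel_measurable_times square_integrable_measurable)
  have "\<bar>x * y\<bar> \<le> x\<^sup>2 + y\<^sup>2" for x y :: real
  proof -
    have "2 * (\<bar>x\<bar> * \<bar>y\<bar>) \<le> x\<^sup>2 + y\<^sup>2"
      using sum_squares_bound[of "\<bar>x\<bar>" "\<bar>y\<bar>"] by (simp add: mult.assoc)
    moreover have "0 \<le> \<bar>x\<bar> * \<bar>y\<bar>"
      by simp
    ultimately show ?thesis
      unfolding abs_mult by linarith
  qed
  then show "AE \<omega> in M. norm (X \<omega> * Y \<omega>) \<le> norm ((X \<omega>)\<^sup>2 + (Y \<omega>)\<^sup>2)"
    by simp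
qed

lemma square_integrable_cmult: "square_integrable M X \<Longrightarrow> square_integrable M (\<lambda>\<omega>. c * X \<omega>)"
  by (auto intro!: borel_measurable_times simp: square_integrable_def power_mult_distrib)

lemma square_integrable_add:
  assumes X: "square_integrable M X" and Y: "square_integrable M Y"
  shows "square_integrable M (\<lambda>\<omega>. X \<omega> + Y \<omega>)"
proof -
  have "integrable M (\<lambda>\<omega>. (X \<omega>)\<^sup>2 + (Y \<omega>)\<^sup>2 + 2 * (X \<omega> * Y \<omega>))"
    using X Y square_integrable_mult[OF X Y]
    by (intro Bochner_Integration.integrable_add integrable_mult_right) (auto simp: square_integrable_def)
  then show ?thesis
    using X Y by (auto intro!: borel_measurable_add simp: square_integrable_def power2_sum mult.assoc)
qed

lemma square_integrable_sum:
  "(\<And>i. i \<in> I \<Longrightarrow> square_integrable M (X i)) \<Longrightarrow> square_integrable M (\<lambda>\<omega>. \<Sum>i\<in>I. X i \<omega>)"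
proof (induction I rule: infinite_finite_induct)
  case (insert i I)
  then show ?case
    by (simp add: square_integrable_add)
qed (simp_all add: square_integrable_def)

lemma square_integrable_cong:
  "(\<And>\<omega>. \<omega> \<in> space M \<Longrightarrow> X \<omega> = Y \<omega>) \<Longrightarrow> square_integrable M X \<longleftrightarrow> square_integrable M Y"
  unfolding square_integrable_def
  by (intro conj_cong measurable_cong Bochner_Integration.integrable_cong) auto

lemma covariance_cong_AE:
  assumes "X \<in> borel_measurable M" "X' \<in> borel_measurable M" "AE \<omega> in M. X \<omega> = X' \<omega>"
    and "Y \<in> borel_measurable M" "Y' \<in> borel_measurable M" "AE \<omega> in M. Y \<omega> = Y' \<omega>"
  shows "covariance M X Y = covariance M X' Y'"
proof -
  have "integral\<^sup>L M X = integral\<^sup>L M X'" "integral\<^sup>L M Y = integral\<^sup>L M Y'"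
    using assms by (auto intro!: integral_cong_AE)
  then show ?thesis
    unfolding covariance_def using assms
    by (intro integral_cong_AE) auto
qed

lemma covariance_cong:
  assumes "\<And>\<omega>. \<omega> \<in> space M \<Longrightarrow> X \<omega> = X' \<omega>" "\<And>\<omega>. \<omega> \<in> space M \<Longrightarrow> Y \<omega> = Y' \<omega>"
  shows "covariance M X Y = covariance M X' Y'"
proof -
  have "integral\<^sup>L M X = integral\<^sup>L M X'" "integral\<^sup>L M Y = integral\<^sup>L M Y'"
    using assms by (auto intro!: Bochner_Integration.integral_cong)
  then show ?thesis
    unfolding covariance_def using assms by (intro Bochner_Integration.integral_cong) auto
qed

lemma covariance_commute: "covariance M X Y = covariance M Y X"
  by (simp add: covariance_def mult.commute)

lemma covariance_cmult_left: "covariance M (\<lambda>\<omega>. c * X \<omega>) Y = c * covariance M X Y"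
proof -
  have "covariance M (\<lambda>\<omega>. c * X \<omega>) Y =
    (LINT \<omega>|M. c * ((X \<omega> - integral\<^sup>L M X) * (Y \<omega> - integral\<^sup>L M Y)))"
    unfolding covariance_def by (simp add: algebra_simps)
  then show ?thesis
    by (simp add: covariance_def)
qed

lemma covariance_cmult_right: "covariance M X (\<lambda>\<omega>. c * Y \<omega>) = c * covariance M X Y"
  by (metis covariance_cmult_left covariance_commute)

context prob_space begin

lemma square_integrable_const: "square_integrable M (\<lambda>_. c)"
  by (simp add: square_integrable_def)

lemma square_integrable_integrable: "square_integrable M X \<Longrightarrow> integrable M X"
  using square_integrable_mult[OF _ square_integrable_const[of 1]] by simp

lemma covariance_eq:
  assumes X: "square_integrable M X" and Y: "square_integrable M Y"
  shows "covariance M X Y = expectation (\<lambda>\<omega>. X \<omega> * Y \<omega>) - expectation X * expectation Y"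
proof -
  note [simp] = square_integrable_integrable[OF X] square_integrable_integrable[OF Y]
    square_integrable_mult[OF X Y]
  have "covariance M X Y = expectation (\<lambda>\<omega>. X \<omega> * Y \<omega> - expectation Y * X \<omega> -
      expectation X * Y \<omega> + expectation X * expectation Y)"
    unfolding covariance_def by (simp add: algebra_simps)
  then show ?thesis
    by (simp add: prob_space)
qed

lemma covariance_add_left:
  assumes X: "square_integrable M X" and Y: "square_integrable M Y" and Z: "square_integrable M Z"
  shows "covariance M (\<lambda>\<omega>. X \<omega> + Y \<omega>) Z = covariance M X Z + covariance M Y Z"
  using square_integrable_integrable[OF X] square_integrable_integrable[OF Y]
    square_integrable_mult[OF X Z] square_integrable_mult[OF Y Z]
  by (simp add: covariance_eq square_integrable_add X Y Z distrib_right)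

lemma covariance_add_right:
  assumes X: "square_integrable M X" and Y: "square_integrable M Y" and Z: "square_integrable M Z"
  shows "covariance M Z (\<lambda>\<omega>. X \<omega> + Y \<omega>) = covariance M Z X + covariance M Z Y"
  using covariance_add_left[OF X Y Z] by (simp only: covariance_commute[of M Z])

lemma covariance_sum_left:
  assumes "\<And>i. i \<in> I \<Longrightarrow> square_integrable M (X i)" "square_integrable M Z"
  shows "covariance M (\<lambda>\<omega>. \<Sum>i\<in>I. X i \<omega>) Z = (\<Sum>i\<in>I. covariance M (X i) Z)"
  using assms
proof (induction I rule: infinite_finite_induct)
  case (insert i I)
  then have "covariance M (\<lambda>\<omega>. X i \<omega> + (\<Sum>i\<in>I. X i \<omega>)) Z =
      covariance M (X i) Z + covariance M (\<lambda>\<omega>. \<Sum>i\<in>I. X i \<omega>) Z"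
    by (intro covariance_add_left square_integrable_sum) auto
  then show ?case
    using insert by simp
qed (simp_all add: covariance_def)

lemma covariance_sum_right:
  assumes "\<And>i. i \<in> I \<Longrightarrow> square_integrable M (X i)" "square_integrable M Z"
  shows "covariance M Z (\<lambda>\<omega>. \<Sum>i\<in>I. X i \<omega>) = (\<Sum>i\<in>I. covariance M Z (X i))"
  using covariance_sum_left[OF assms] by (simp only: covariance_commute[of M Z])

lemma covariance_self_nonneg: "0 \<le> covariance M X X"
  unfolding covariance_def by simp

lemma covariance_indep_var_eq_0:
  assumes "indep_var borel X borel Y" "square_integrable M X" "square_integrable M Y"
  shows "covariance M X Y = 0"
  using assms by (simp add: covariance_eq indep_var_lebesgue_integral square_integrable_integrable)

text \<open>Composition only shrinks the generated families of events. The lemma passes from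
  independence of a vector and a path, which have different types, to \<open>indep_var\<close> for
  their images in a common type.\<close>

lemma independent_rv_compose:
  assumes ind: "independent_rv M L X N Y"
    and f: "f \<in> measurable L L'" and g: "g \<in> measurable N N'"
  shows "indep_var L' (\<lambda>\<omega>. f (X \<omega>)) N' (\<lambda>\<omega>. g (Y \<omega>))"
proof -
  have X: "X \<in> measurable M L" and Y: "Y \<in> measurable M N"
    and I: "indep_set {X -` B \<inter> space M | B. B \<in> sets L} {Y -` B \<inter> space M | B. B \<in> sets N}"
    using ind unfolding independent_rv_def by auto
  have sub: "{(\<lambda>\<omega>. h (Z \<omega>)) -` B \<inter> space M | B. B \<in> sets K'} \<subseteq> {Z -` B \<inter> space M | B. B \<in> sets K}"
    if "h \<in> measurable K K'" "Z \<in> measurable M K" for h K K' and Z :: "'a \<Rightarrow> 'z"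
  proof safe
    fix B assume "B \<in> sets K'"
    then have "h -` B \<inter> space K \<in> sets K"
      using that by (auto intro: measurable_sets)
    moreover have "(\<lambda>\<omega>. h (Z \<omega>)) -` B \<inter> space M = Z -` (h -` B \<inter> space K) \<inter> space M"
      using measurable_space[OF that(2)] by auto
    ultimately show "\<exists>B'. (\<lambda>\<omega>. h (Z \<omega>)) -` B \<inter> space M = Z -` B' \<inter> space M \<and> B' \<in> sets K"
      by blast
  qed
  have "indep_vars (case_bool L' N') (case_bool (\<lambda>\<omega>. f (X \<omega>)) (\<lambda>\<omega>. g (Y \<omega>))) UNIV"
    unfolding indep_vars_def2
  proof
    show "\<forall>i\<in>UNIV. random_variable (case_bool L' N' i) (case_bool (\<lambda>\<omega>. f (X \<omega>)) (\<lambda>\<omega>. g (Y \<omega>)) i)"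
      using measurable_compose[OF X f] measurable_compose[OF Y g] by (simp split: bool.split)
    show "indep_sets (\<lambda>i. {case_bool (\<lambda>\<omega>. f (X \<omega>)) (\<lambda>\<omega>. g (Y \<omega>)) i -` B \<inter> space M |B.
        B \<in> sets (case_bool L' N' i)}) UNIV"
    proof (rule indep_sets_mono_sets[OF I[unfolded indep_set_def]])
      fix b :: bool
      show "{case_bool (\<lambda>\<omega>. f (X \<omega>)) (\<lambda>\<omega>. g (Y \<omega>)) b -` B \<inter> space M |B. B \<in> sets (case_bool L' N' b)}
        \<subseteq> case_bool {X -` B \<inter> space M |B. B \<in> sets L} {Y -` B \<inter> space M |B. B \<in> sets N} b"
        using sub[OF f X] sub[OF g Y] by (cases b) simp_all
    qed
  qed
  then show ?thesis
    unfolding indep_var_def .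
qed

section \<open>Moments and covariances of Wiener increments\<close>

lemma wiener_increment_moments:
  assumes W: "wiener_process M T X" and s: "0 \<le> s" "s \<le> u" "u \<le> T"
  shows "square_integrable M (\<lambda>\<omega>. X u \<omega> - X s \<omega>)"
    and "s < u \<Longrightarrow> covariance M (\<lambda>\<omega>. X u \<omega> - X s \<omega>) (\<lambda>\<omega>. X u \<omega> - X s \<omega>) = u - s"
proof -
  let ?D = "\<lambda>\<omega>. X u \<omega> - X s \<omega>"
  have [measurable]: "X u \<in> borel_measurable M" "X s \<in> borel_measurable M"
    using W s unfolding wiener_process_def by auto
  have law: "distr M borel ?D = normal_law 0 (sqrt (u - s))"
    using W s unfolding wiener_process_def by auto
  have dist: "distributed M lborel ?D (normal_density 0 (sqrt (u - s)))" if "s < u"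
  proof -
    have "distr M lborel ?D = distr M borel ?D"
      by (rule distr_cong) auto
    then show ?thesis
      using that law unfolding distributed_def normal_law_def by simp
  qed
  \<comment> \<open>For \<open>s = u\<close> the law is a point mass without density, but the
    increment is then identically 0.\<close>
  show "square_integrable M ?D"
  proof (cases "s < u")
    case True
    have "integrable lborel (\<lambda>x. normal_density 0 (sqrt (u - s)) x * x\<^sup>2)"
      using integrable_normal_moment[of "sqrt (u - s)" 0 2] True by simp
    then have "integrable M (\<lambda>\<omega>. (?D \<omega>)\<^sup>2)"
      by (subst (asm) distributed_integrable[OF dist[OF True]]) auto
    then show ?thesis
      by (simp add: square_integrable_def)
  qed (use s square_integrable_const[of 0] in auto)
  show "covariance M ?D ?D = u - s" if "s < u"
    using normal_distributed_variance[OF _ dist[OF that]] that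
    by (simp add: covariance_def power2_eq_square)
qed

text \<open>The hypothesis gives covariances at single times only. Splitting the path up to
  \<open>u\<close> into independent increments over [0, s] and [s, u] makes covariances add, and the
  wanted one is a difference. Increments start from \<open>W 0\<close>, which vanishes only almost
  surely.\<close>

lemma correlated_wiener_increment_covariance:
  fixes W :: "real \<Rightarrow> 'a \<Rightarrow> real^'d"
  assumes W: "correlated_wiener_processes M T W"
    and cov: "\<And>s m n. s \<in> {0..T} \<Longrightarrow>
          covariance M (\<lambda>\<omega>. \<sigma> m * W s \<omega> $ m) (\<lambda>\<omega>. \<sigma> n * W s \<omega> $ n) = s * \<Sigma> m n"
    and s: "0 \<le> s" "s \<le> u" "u \<le> T"
  shows "covariance M (\<lambda>\<omega>. \<sigma> m * (W u \<omega> $ m - W s \<omega> $ m)) (\<lambda>\<omega>. \<sigma> n * (W u \<omega> $ n - W s \<omega> $ n)) =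
    (u - s) * \<Sigma> m n"
proof -
  have Wn: "wiener_process M T (\<lambda>s \<omega>. W s \<omega> $ n)" for n
    using W unfolding correlated_wiener_processes_def by auto
  have meas [measurable]: "(\<lambda>\<omega>. W r \<omega> $ n) \<in> borel_measurable M" if "r \<in> {0..T}" for r n
    using Wn that unfolding wiener_process_def by blast
  have W0: "AE \<omega> in M. W 0 \<omega> $ n = 0" for n
    using Wn unfolding wiener_process_def by blast
  define a where "a n = (\<lambda>\<omega>. \<sigma> n * (W s \<omega> $ n - W 0 \<omega> $ n))" for n
  define d where "d n = (\<lambda>\<omega>. \<sigma> n * (W u \<omega> $ n - W s \<omega> $ n))" for n
  have a: "square_integrable M (a n)" for n
    unfolding a_def using s by (intro square_integrable_cmult wiener_increment_moments(1)[OF Wn]) auto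
  have d: "square_integrable M (d n)" for n
    unfolding d_def using s by (intro square_integrable_cmult wiener_increment_moments(1)[OF Wn]) auto
  have zero: "covariance M (a m) (d n) = 0" for m n
  proof -
    \<comment> \<open>The partition 0, s, u, whose two increments are the ones to be
      separated.\<close>
    define p where "p k = (if k = 0 then 0 else if k = 1 then s else u)" for k :: nat
    have "indep_vars (\<lambda>_. borel) (\<lambda>k \<omega>. W (p (Suc k)) \<omega> - W (p k) \<omega>) {..<2}"
    proof -
      have "has_independent_increments M T W"
        using W unfolding correlated_wiener_processes_def by blast
      moreover have "(\<forall>k\<le>2. p k \<in> {0..T}) \<and> (\<forall>k<2. p k \<le> p (Suc k))"
        using s by (auto simp: p_def)
      ultimately show ?thesis
        unfolding has_independent_increments_def by blast
    qed
    then have "indep_vars (\<lambda>_. borel) (\<lambda>k \<omega>. (\<lambda>x. if k = 0 then \<sigma> m * x $ m else \<sigma> n * x $ n)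
        (W (p (Suc k)) \<omega> - W (p k) \<omega>)) {..<2}"
      by (rule indep_vars_compose2) auto
    then have ind: "indep_vars (\<lambda>_. borel) (\<lambda>k. if k = 0 then a m else d n) {..<2::nat}"
      by (rule indep_vars_cong[THEN iffD1, rotated 3]) (auto simp: p_def a_def d_def fun_eq_iff less_2_cases_iff)
    have "expectation (\<lambda>\<omega>. \<Prod>k<2::nat. (if k = 0 then a m else d n) \<omega>) =
        (\<Prod>k<2::nat. expectation (if k = 0 then a m else d n))"
      by (rule indep_vars_lebesgue_integral[OF _ ind])
        (auto intro: square_integrable_integrable a d)
    then have "expectation (\<lambda>\<omega>. a m \<omega> * d n \<omega>) = expectation (a m) * expectation (d n)"
      by (simp add: numeral_2_eq_2)
    then show ?thesis
      by (simp add: covariance_eq a d)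
  qed
  have from0: "covariance M (\<lambda>\<omega>. \<sigma> m * (W r \<omega> $ m - W 0 \<omega> $ m)) (\<lambda>\<omega>. \<sigma> n * (W r \<omega> $ n - W 0 \<omega> $ n)) =
      r * \<Sigma> m n" if r: "r \<in> {0..T}" for r
  proof -
    have "0 \<in> {0..T}"
      using r by simp
    moreover have "AE \<omega> in M. \<sigma> k * (W r \<omega> $ k - W 0 \<omega> $ k) = \<sigma> k * W r \<omega> $ k" for k
      using W0[of k] by eventually_elim simp
    ultimately show ?thesis
      unfolding cov[OF r, symmetric] using r by (intro covariance_cong_AE) auto
  qed
  have "covariance M (a m) (a n) = s * \<Sigma> m n"
    unfolding a_def using s by (intro from0) auto
  moreover have "covariance M (\<lambda>\<omega>. a m \<omega> + d m \<omega>) (\<lambda>\<omega>. a n \<omega> + d n \<omega>) = u * \<Sigma> m n"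
    using from0[of u] s unfolding a_def d_def by (simp add: distrib_left[symmetric])
  moreover have "covariance M (\<lambda>\<omega>. a m \<omega> + d m \<omega>) (\<lambda>\<omega>. a n \<omega> + d n \<omega>) =
      covariance M (a m) (a n) + covariance M (d m) (d n)"
    using zero[of m n] zero[of n m] covariance_commute[of M "d m" "a n"]
    by (simp add: covariance_add_left covariance_add_right square_integrable_add a d)
  ultimately show ?thesis
    unfolding d_def by (simp add: algebra_simps)
qed

end


section \<open>Convergence of the estimators\<close>

text \<open>The limit is an expectation on \<open>P\<close> while the copies live on
  \<open>Q\<close>; the common law on \<open>L\<close> carries integrability and mean
  across.\<close>

lemma strong_law_of_large_numbers_copies:
  fixes f :: "'c \<Rightarrow> real"
  assumes Q: "prob_space Q"
    and ind: "prob_space.indep_vars Q (\<lambda>_. L) Y {1..}"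
    and law: "\<And>l. l \<ge> 1 \<Longrightarrow> distr Q L (Y l) = distr P L Z"
    and Z: "Z \<in> measurable P L" and f: "f \<in> borel_measurable L"
    and int: "integrable P (\<lambda>\<omega>. f (Z \<omega>))"
  shows "AE \<omega> in Q. (\<lambda>N. (\<Sum>l=1..N. f (Y l \<omega>)) / real N) \<longlonglongrightarrow> (LINT \<omega>|P. f (Z \<omega>))"
proof -
  interpret Q: prob_space Q by fact
  note f [measurable] Z [measurable]
  have Y [measurable]: "Y (Suc n) \<in> measurable Q L" for n
    using ind unfolding Q.indep_vars_def by auto
  have "Q.indep_vars (\<lambda>_. L) (\<lambda>n. Y (Suc n)) UNIV"
    by (rule Q.indep_vars_reindex_inj[OF ind]) auto
  then have iv: "Q.indep_vars (\<lambda>_. borel) (\<lambda>n \<omega>. f (Y (Suc n) \<omega>)) UNIV"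
    by (rule Q.indep_vars_compose2) (rule f)
  have d: "distr Q borel (\<lambda>\<omega>. f (Y (Suc n) \<omega>)) = distr P borel (\<lambda>\<omega>. f (Z \<omega>))" for n
  proof -
    have "distr Q borel (\<lambda>\<omega>. f (Y (Suc n) \<omega>)) = distr (distr Q L (Y (Suc n))) borel f"
      by (subst distr_distr) (auto simp: comp_def)
    also have "\<dots> = distr (distr P L Z) borel f"
      by (subst law) auto
    also have "\<dots> = distr P borel (\<lambda>\<omega>. f (Z \<omega>))"
      by (subst distr_distr) (auto simp: comp_def)
    finally show ?thesis .
  qed
  have "integrable (distr P borel (\<lambda>\<omega>. f (Z \<omega>))) (\<lambda>x. x)"
    using int by (subst integrable_distr_eq) auto
  then have "integrable Q (\<lambda>\<omega>. f (Y (Suc 0) \<omega>))"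
    unfolding d[of 0, symmetric] by (subst (asm) integrable_distr_eq) auto
  moreover have "Q.expectation (\<lambda>\<omega>. f (Y (Suc 0) \<omega>)) = (LINT \<omega>|P. f (Z \<omega>))"
  proof -
    have "Q.expectation (\<lambda>\<omega>. f (Y (Suc 0) \<omega>)) = integral\<^sup>L (distr Q borel (\<lambda>\<omega>. f (Y (Suc 0) \<omega>))) (\<lambda>x. x)"
      by (subst integral_distr) auto
    also have "\<dots> = (LINT \<omega>|P. f (Z \<omega>))"
      unfolding d by (subst integral_distr) auto
    finally show ?thesis .
  qed
  ultimately have "AE \<omega> in Q. (\<lambda>n. (\<Sum>i<n. f (Y (Suc i) \<omega>)) / real n) \<longlonglongrightarrow> (LINT \<omega>|P. f (Z \<omega>))"
    using Q.strong_law_of_large_numbers[OF iv] by (simp add: d)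
  moreover have "(\<Sum>i<n. f (Y (Suc i) \<omega>)) = (\<Sum>l=1..n. f (Y l \<omega>))" for n \<omega>
    by (simp add: sum.atLeast1_atMost_eq)
  ultimately show ?thesis
    by simp
qed

text \<open>The sample covariance is N/(N-1) times the mean product minus the product of means, so
  three averages determine its limit.\<close>

lemma sample_cov_tendsto:
  fixes S :: "nat \<Rightarrow> real \<Rightarrow> real^'d"
  assumes p: "(\<lambda>N. (\<Sum>l=1..N. price_incr t S i k l * price_incr t S j k l) / real N) \<longlonglongrightarrow> p"
    and a: "(\<lambda>N. (\<Sum>l=1..N. price_incr t S i k l) / real N) \<longlonglongrightarrow> a"
    and b: "(\<lambda>N. (\<Sum>l=1..N. price_incr t S j k l) / real N) \<longlonglongrightarrow> b"
  shows "(\<lambda>N. sample_cov t S N k i j) \<longlonglongrightarrow> p - a * b"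
proof -
  let ?X = "price_incr t S i k" and ?Y = "price_incr t S j k"
  have eq: "sample_cov t S N k i j = (real N / (real N - 1)) *
      ((\<Sum>l=1..N. ?X l * ?Y l) / real N - (\<Sum>l=1..N. ?X l) / real N * ((\<Sum>l=1..N. ?Y l) / real N))"
    if "N \<ge> 2" for N
  proof -
    define x y where "x = mean_incr t S N i k" and "y = mean_incr t S N j k"
    have sx: "(\<Sum>l=1..N. ?X l) = real N * x" and sy: "(\<Sum>l=1..N. ?Y l) = real N * y"
      using that by (simp_all add: x_def y_def mean_incr_def)
    have "(\<Sum>l=1..N. (?X l - x) * (?Y l - y)) =
        (\<Sum>l=1..N. ?X l * ?Y l - y * ?X l - x * ?Y l + x * y)"
      by (intro sum.cong) (auto simp: algebra_simps)
    also have "\<dots> = (\<Sum>l=1..N. ?X l * ?Y l) - y * (\<Sum>l=1..N. ?X l) - x * (\<Sum>l=1..N. ?Y l) + real N * (x * y)"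
      by (simp add: sum.distrib sum_subtractf sum_distrib_left)
    also have "\<dots> = (\<Sum>l=1..N. ?X l * ?Y l) - real N * (x * y)"
      unfolding sx sy by (simp add: algebra_simps)
    finally have "sample_cov t S N k i j = ((\<Sum>l=1..N. ?X l * ?Y l) - real N * (x * y)) / (real N - 1)"
      by (simp add: sample_cov_def x_def y_def)
    moreover have "(\<Sum>l=1..N. ?X l * ?Y l) / real N - real N * x / real N * (real N * y / real N) =
        ((\<Sum>l=1..N. ?X l * ?Y l) - real N * (x * y)) / real N"
      using that by (simp add: diff_divide_distrib)
    ultimately show ?thesis
      unfolding sx sy using that by simp
  qed
  have "(\<lambda>N. real N / (real N - 1)) \<longlonglongrightarrow> 1"
    by real_asymp
  then have "(\<lambda>N. (real N / (real N - 1)) * ((\<Sum>l=1..N. ?X l * ?Y l) / real N -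
      (\<Sum>l=1..N. ?X l) / real N * ((\<Sum>l=1..N. ?Y l) / real N))) \<longlonglongrightarrow> 1 * (p - a * b)"
    by (intro tendsto_intros p a b)
  then have "(\<lambda>N. (real N / (real N - 1)) * ((\<Sum>l=1..N. ?X l * ?Y l) / real N -
      (\<Sum>l=1..N. ?X l) / real N * ((\<Sum>l=1..N. ?Y l) / real N))) \<longlonglongrightarrow> p - a * b"
    by simp
  then show ?thesis
  proof (rule Lim_transform_eventually)
    show "eventually (\<lambda>N. (real N / (real N - 1)) * ((\<Sum>l=1..N. ?X l * ?Y l) / real N -
        (\<Sum>l=1..N. ?X l) / real N * ((\<Sum>l=1..N. ?Y l) / real N)) = sample_cov t S N k i j) sequentially"
      by (rule eventually_sequentiallyI[of 2]) (rule eq[symmetric])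
  qed
qed

text \<open>Bilinearity: the four families of covariances are the expansion of a single one.\<close>

lemma excess_eq_covariance:
  assumes P: "prob_space P"
    and pi: "\<And>n l. square_integrable P (\<lambda>\<omega>. pi_term t H k n l (E \<omega>))"
    and theta: "\<And>n l. square_integrable P (\<lambda>\<omega>. theta_term t T G k n l (\<mu> \<omega>))"
  shows "excess P t T H G E \<mu> k i j =
    covariance P (\<lambda>\<omega>. \<Sum>l\<in>UNIV. pi_term t H k i l (E \<omega>) + theta_term t T G k i l (\<mu> \<omega>))
      (\<lambda>\<omega>. \<Sum>l\<in>UNIV. pi_term t H k j l (E \<omega>) + theta_term t T G k j l (\<mu> \<omega>))"
proof -
  interpret prob_space P by fact
  show ?thesis
    by (simp add: excess_def Let_def covariance_sum_left covariance_sum_right covariance_add_left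
        covariance_add_right square_integrable_add square_integrable_sum pi theta add_ac)
qed

lemma borel_measurable_vec_nth [measurable]: "(\<lambda>x :: real^'n. x $ i) \<in> borel_measurable borel"
  by (intro borel_measurable_continuous_onI continuous_on_component continuous_on_id)

theorem mainTheorem5:
  fixes T \<gamma> :: real
    and \<sigma> V \<eta> \<alpha> A :: "'d::finite \<Rightarrow> real"
    and \<Sigma> :: "real^'d^'d"
    and P :: "'a measure"
    and E\<^sub>0 :: "'a \<Rightarrow> real^'d"
    and W :: "real \<Rightarrow> 'a \<Rightarrow> real^'d"
    and E \<mu> :: "'a \<Rightarrow> real \<Rightarrow> real^'d"
    and H :: "real \<Rightarrow> real^'d^'d"
    and \<Phi> G :: "real \<Rightarrow> real \<Rightarrow> real^'d^'d"
    and t :: "nat \<Rightarrow> real"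
    and M k :: nat
    and Q :: "'b measure"
    and E\<^sub>0d :: "nat \<Rightarrow> 'b \<Rightarrow> real^'d"
    and Wd :: "nat \<Rightarrow> real \<Rightarrow> 'b \<Rightarrow> real^'d"
    and Ed \<mu>d S :: "nat \<Rightarrow> 'b \<Rightarrow> real \<Rightarrow> real^'d"
    and \<rho> :: "'d \<Rightarrow> 'd \<Rightarrow> real"
    and i j :: 'd
  assumes "T > 0" and "\<gamma> \<ge> 0"
    and "\<And>n. \<sigma> n > 0" and "\<And>n. V n > 0" and "\<And>n. \<eta> n > 0" and "\<And>n. \<alpha> n \<ge> 0" and "\<And>n. A n > 0"
    \<comment> \<open>the Wiener processes and the covariance matrix of \<open>(\<sigma>\<^sub>n W\<^sup>n)\<^sub>n\<close> per unit time\<close>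
    and "prob_space P"
    and "correlated_wiener_processes P T W"
    and "\<And>s m n. s \<in> {0..T} \<Longrightarrow>
          covariance P (\<lambda>\<omega>. \<sigma> m * W s \<omega> $ m) (\<lambda>\<omega>. \<sigma> n * W s \<omega> $ n) = s * \<Sigma> $ m $ n"
    and "invertible \<Sigma>"
    \<comment> \<open>the initial position\<close>
    and "E\<^sub>0 \<in> borel_measurable P"
    and "integrable P (\<lambda>\<omega>. (norm (E\<^sub>0 \<omega>))\<^sup>2)"
    and "independent_rv P borel E\<^sub>0 (path_space T) (path_on T W)"
    \<comment> \<open>the mean field\<close>
    and "mean_field_uniquely_solvable T (VV V \<eta>) (diag_mat \<alpha>) (diag_mat A) \<gamma> \<Sigma>"
    and "\<And>\<omega>. \<omega> \<in> space P \<Longrightarrow>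
          mean_field_solution T (VV V \<eta>) (diag_mat \<alpha>) (diag_mat A) \<gamma> \<Sigma> (E\<^sub>0 \<omega>) (E \<omega>) (\<mu> \<omega>)"
    and "riccati_solution T (VV V \<eta>) (diag_mat A) \<gamma> \<Sigma> H"
    and "is_ordered_exponential T (\<lambda>s. 2 *\<^sub>R (H s ** VV V \<eta>)) \<Phi>"
    and "\<And>s w. G s w = \<Phi> s w ** diag_mat \<alpha>"
    \<comment> \<open>the observed days \<open>l = 1, 2, \<dots>\<close> carry independent copies of \<open>(E\<^sub>0, W)\<close>\<close>
    and "prob_space Q"
    and "prob_space.indep_vars Q (\<lambda>_. borel \<Otimes>\<^sub>M path_space T)
          (\<lambda>l \<omega>. (E\<^sub>0d l \<omega>, path_on T (Wd l) \<omega>)) {1..}"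
    and "\<And>l. l \<ge> 1 \<Longrightarrow>
          distr Q (borel \<Otimes>\<^sub>M path_space T) (\<lambda>\<omega>. (E\<^sub>0d l \<omega>, path_on T (Wd l) \<omega>)) =
          distr P (borel \<Otimes>\<^sub>M path_space T) (\<lambda>\<omega>. (E\<^sub>0 \<omega>, path_on T W \<omega>))"
    and "\<And>l \<omega>. l \<ge> 1 \<Longrightarrow> \<omega> \<in> space Q \<Longrightarrow>
          mean_field_solution T (VV V \<eta>) (diag_mat \<alpha>) (diag_mat A) \<gamma> \<Sigma> (E\<^sub>0d l \<omega>) (Ed l \<omega>) (\<mu>d l \<omega>)"
    and "\<And>l. l \<ge> 1 \<Longrightarrow> AE \<omega> in Q. \<forall>n. \<forall>s\<in>{0..T}.
          S l \<omega> s $ n = S l \<omega> 0 $ n + \<sigma> n * (Wd l s \<omega> $ n - Wd l 0 \<omega> $ n)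
                        + integral {0..s} (\<lambda>r. \<alpha> n * \<mu>d l \<omega> r $ n)"
    \<comment> \<open>the observation times\<close>
    and "t 1 = 0" and "t M = T" and "strict_mono_on {1..M} t"
    and "\<And>m n. \<rho> m n = \<Sigma> $ m $ n / sqrt (\<Sigma> $ m $ m * \<Sigma> $ n $ n)"
    and "1 \<le> k" and "k \<le> M - 1" and "i \<noteq> j"
  shows "\<exists>\<epsilon> :: nat \<Rightarrow> 'b \<Rightarrow> real.
    (\<forall>N\<ge>2. \<forall>\<omega>\<in>space Q.
       estimated_corr t (\<lambda>l. S l \<omega>) N k i j =
         \<rho> i j * A_coeff t \<Sigma> (\<lambda>l. S l \<omega>) N k i j
         + B_coeff t \<alpha> V \<eta> (excess P t T H G E \<mu> k) (\<lambda>l. S l \<omega>) N k i j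
         + \<epsilon> N \<omega>) \<and>
    (AE \<omega> in Q. (\<lambda>N. \<epsilon> N \<omega>) \<longlonglongrightarrow> 0)"
proof -
  interpret P: prob_space P by fact
  interpret Q: prob_space Q by fact
  \<comment> \<open>Truncated subtraction does no harm: \<open>1 \<le> k\<close> and
    \<open>k \<le> M - 1\<close> force \<open>M \<ge> 2\<close>.\<close>
  have k: "k \<in> {1..M}" "k + 1 \<in> {1..M}" and M: "1 \<in> {1..M}" "M \<in> {1..M}"
    using assms(29,30) by auto
  have t: "0 \<le> t k" "t k < t (k + 1)" "t (k + 1) \<le> T"
    using strict_mono_on_leD[OF assms(27) M(1) k(1)] strict_mono_onD[OF assms(27) k]
      strict_mono_on_leD[OF assms(27) k(2) M(2)] assms(25,26) k by auto
  have tT: "t k \<in> {0..T}" "t (k + 1) \<in> {0..T}" and T: "0 \<le> T"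
    using t by auto
  obtain EB \<mu>B where B: "\<And>b. mean_field_solution T (VV V \<eta>) (diag_mat \<alpha>) (diag_mat A) \<gamma> \<Sigma> (axis b 1) (EB b) (\<mu>B b)"
    and superpos: "\<And>x E \<mu> s. mean_field_solution T (VV V \<eta>) (diag_mat \<alpha>) (diag_mat A) \<gamma> \<Sigma> x E \<mu> \<Longrightarrow>
      s \<in> {0..T} \<Longrightarrow> E s = (\<Sum>b\<in>UNIV. x $ b *\<^sub>R EB b s) \<and> \<mu> s = (\<Sum>b\<in>UNIV. x $ b *\<^sub>R \<mu>B b s)"
    using mean_field_solution_superposition[OF assms(15)] by blast
  note cB = mean_field_solution_continuous[OF B]
  have cH: "continuous_on {0..T} H"
    using assms(17) unfolding riccati_solution_def by (auto intro!: has_vector_derivative_imp_continuous_on)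
  have K: "continuous_on {0..T} (\<lambda>s. 2 *\<^sub>R (H s ** VV V \<eta>))"
    unfolding matrix_matrix_mult_def by (intro continuous_intros cH)

  \<comment> \<open>The drift that a unit initial position in direction \<open>b\<close> contributes
    to the increment of asset \<open>n\<close>.\<close>
  define c where "c n b = \<alpha> n * integral {t k..t (k + 1)} (\<lambda>s. \<mu>B b s $ n)" for n b
  have drift: "\<alpha> n * integral {t k..t (k + 1)} (\<lambda>s. m s $ n) = (\<Sum>b\<in>UNIV. x $ b * c n b)"
    if sol: "mean_field_solution T (VV V \<eta>) (diag_mat \<alpha>) (diag_mat A) \<gamma> \<Sigma> x F m" for x F m n
  proof -
    have "integral {t k..t (k + 1)} (\<lambda>s. m s $ n) =
        integral {t k..t (k + 1)} (\<lambda>s. \<Sum>b\<in>UNIV. x $ b * \<mu>B b s $ n)"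
      using t superpos[OF sol] by (intro integral_cong) auto
    also have "\<dots> = (\<Sum>b\<in>UNIV. integral {t k..t (k + 1)} (\<lambda>s. x $ b * \<mu>B b s $ n))"
      using t by (intro integral_sum integrable_continuous_real continuous_intros
          continuous_on_subset[OF cB(2)]) auto
    finally show ?thesis
      by (simp add: c_def sum_distrib_left mult_ac)
  qed

  \<comment> \<open>The price increment as a function of initial position and path, reading the path
    at two observation times only. The same \<open>f\<close> is evaluated at \<open>Z\<close> and at
    each day's \<open>Y l\<close>.\<close>
  define f where "f n = (\<lambda>(x :: real^'d, p :: real \<Rightarrow> real^'d).
      \<sigma> n * (p (t (k + 1)) $ n - p (t k) $ n) + (\<Sum>b\<in>UNIV. x $ b * c n b))" for n
  define D where "D n \<omega> = (\<Sum>b\<in>UNIV. E\<^sub>0 \<omega> $ b * c n b)" for n \<omega>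
  define R where "R n \<omega> = \<sigma> n * (W (t (k + 1)) \<omega> $ n - W (t k) \<omega> $ n)" for n \<omega>
  define Z where "Z \<omega> = (E\<^sub>0 \<omega>, path_on T W \<omega>)" for \<omega>
  define Y where "Y l \<omega> = (E\<^sub>0d l \<omega>, path_on T (Wd l) \<omega>)" for l \<omega>
  have fZ: "f n (Z \<omega>) = R n \<omega> + D n \<omega>" for n \<omega>
    using tT by (simp add: f_def Z_def R_def D_def path_on_def)
  have eval [measurable]: "(\<lambda>p. p r) \<in> measurable (path_space T) (borel :: (real^'d) measure)"
    if "r \<in> {0..T}" for r
    using that by (rule measurable_component_singleton)
  have fm [measurable]: "f n \<in> borel_measurable (borel \<Otimes>\<^sub>M path_space T)" for n
  proof -
    have [measurable]: "(\<lambda>z. snd z r $ n) \<in> borel_measurable (borel \<Otimes>\<^sub>M path_space T)"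
      if "r \<in> {0..T}" for r and n :: 'd
      by (rule measurable_compose[OF measurable_compose[OF measurable_snd eval[OF that]] borel_measurable_vec_nth])
    show ?thesis
      unfolding f_def split_beta using tT by measurable
  qed
  have Zm: "Z \<in> measurable P (borel \<Otimes>\<^sub>M path_space T)"
    using assms(14) unfolding Z_def independent_rv_def by (intro measurable_Pair) auto

  have E0: "square_integrable P (\<lambda>\<omega>. E\<^sub>0 \<omega> $ b)" for b
    unfolding square_integrable_def
  proof
    show m: "(\<lambda>\<omega>. E\<^sub>0 \<omega> $ b) \<in> borel_measurable P"
      by (rule measurable_compose[OF assms(12) borel_measurable_vec_nth])
    show "integrable P (\<lambda>\<omega>. (E\<^sub>0 \<omega> $ b)\<^sup>2)"
      using assms(13)
    proof (rule Bochner_Integration.integrable_bound)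
      show "AE \<omega> in P. norm ((E\<^sub>0 \<omega> $ b)\<^sup>2) \<le> norm ((norm (E\<^sub>0 \<omega>))\<^sup>2)"
      proof (rule AE_I2)
        fix \<omega>
        show "norm ((E\<^sub>0 \<omega> $ b)\<^sup>2) \<le> norm ((norm (E\<^sub>0 \<omega>))\<^sup>2)"
          using power_mono[OF component_le_norm_cart abs_ge_zero, of "E\<^sub>0 \<omega>" b 2] by simp
      qed
      show "(\<lambda>\<omega>. (E\<^sub>0 \<omega> $ b)\<^sup>2) \<in> borel_measurable P"
        using m by (rule borel_measurable_power)
    qed
  qed
  have lin: "square_integrable P (\<lambda>\<omega>. \<Sum>b\<in>UNIV. E\<^sub>0 \<omega> $ b * a b)" for a
    using square_integrable_sum[OF square_integrable_cmult[OF E0]] by (simp only: mult.commute)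
  have D: "square_integrable P (D n)" for n
    unfolding D_def by (rule lin)
  have R: "square_integrable P (R n)" for n
    unfolding R_def using assms(9) t unfolding correlated_wiener_processes_def
    by (intro square_integrable_cmult P.wiener_increment_moments(1)[where X="\<lambda>s \<omega>. W s \<omega> $ n"]) auto
  have RD: "square_integrable P (\<lambda>\<omega>. f n (Z \<omega>))" for n
    unfolding fZ by (rule square_integrable_add[OF R D])

  have covR: "covariance P (R m) (R n) = (t (k + 1) - t k) * \<Sigma> $ m $ n" for m n
    unfolding R_def using t
    by (intro P.correlated_wiener_increment_covariance[OF assms(9,10)]) auto
  \<comment> \<open>\<open>D m\<close> depends on \<open>E\<^sub>0\<close> alone and
    \<open>R n\<close> on the path alone, so this is where their independence enters.\<close>
  have cov0: "covariance P (D m) (R n) = 0" for m n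
  proof (rule P.covariance_indep_var_eq_0[OF _ D R])
    have "P.indep_var borel (\<lambda>\<omega>. (\<lambda>x. \<Sum>b\<in>UNIV. x $ b * c m b) (E\<^sub>0 \<omega>))
        borel (\<lambda>\<omega>. (\<lambda>p. \<sigma> n * (p (t (k + 1)) $ n - p (t k) $ n)) (path_on T W \<omega>))"
    proof (rule P.independent_rv_compose[OF assms(14)])
      show "(\<lambda>p. \<sigma> n * (p (t (k + 1)) $ n - p (t k) $ n)) \<in> borel_measurable (path_space T)"
        using tT by (intro borel_measurable_times borel_measurable_diff borel_measurable_const
            measurable_compose[OF eval borel_measurable_vec_nth])
    qed measurable
    then show "P.indep_var borel (D m) borel (R n)"
      using tT by (simp add: D_def[abs_def] R_def[abs_def] path_on_def)
  qed
  have covZ: "covariance P (\<lambda>\<omega>. f m (Z \<omega>)) (\<lambda>\<omega>. f n (Z \<omega>)) =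
      (t (k + 1) - t k) * \<Sigma> $ m $ n + covariance P (D m) (D n)" for m n
    unfolding fZ using cov0[of m n] cov0[of n m] covariance_commute[of P "R m" "D n"]
    by (simp add: P.covariance_add_left P.covariance_add_right square_integrable_add R D covR)

  \<comment> \<open>The drift is computed twice: by superposition it is \<open>D n\<close>, and by
    the Riccati representation it is a multiple of the sum of the \<open>\<pi>\<close> and
    \<open>\<theta>\<close> terms.\<close>
  have covD: "covariance P (D m) (D n) =
      \<alpha> m * \<alpha> n * V m * V n * excess P t T H G E \<mu> k m n / (4 * \<eta> m * \<eta> n)" for m n
  proof -
    define X where "X n \<omega> = (\<Sum>l\<in>UNIV. pi_term t H k n l (E \<omega>) + theta_term t T G k n l (\<mu> \<omega>))" for n \<omega>
    have pi: "square_integrable P (\<lambda>\<omega>. pi_term t H k n l (E \<omega>))" for n l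
    proof (subst square_integrable_cong)
      show "pi_term t H k n l (E \<omega>) = (\<Sum>b\<in>UNIV. E\<^sub>0 \<omega> $ b * pi_term t H k n l (EB b))"
        if "\<omega> \<in> space P" for \<omega>
        using superpos[OF assms(16)[OF that]] by (intro pi_term_superposition[OF t(1,3) cH cB(1)]) auto
    qed (rule lin)
    have theta: "square_integrable P (\<lambda>\<omega>. theta_term t T G k n l (\<mu> \<omega>))" for n l
    proof (subst square_integrable_cong)
      show "theta_term t T G k n l (\<mu> \<omega>) = (\<Sum>b\<in>UNIV. E\<^sub>0 \<omega> $ b * theta_term t T G k n l (\<mu>B b))"
        if "\<omega> \<in> space P" for \<omega>
        using superpos[OF assms(16)[OF that]]
        by (intro theta_term_superposition[OF T K assms(18,19) t(1,3) cB(2)]) auto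
    qed (rule lin)
    have "D n \<omega> = \<alpha> n * V n / (2 * \<eta> n) * X n \<omega>" if "\<omega> \<in> space P" for n \<omega>
      using drift[OF assms(16)[OF that], of n]
        mean_field_drift_decomposition[OF T assms(17,18,19) assms(16)[OF that] t(1,3), of n]
      by (simp add: D_def X_def)
    then have "covariance P (D m) (D n) =
        covariance P (\<lambda>\<omega>. \<alpha> m * V m / (2 * \<eta> m) * X m \<omega>) (\<lambda>\<omega>. \<alpha> n * V n / (2 * \<eta> n) * X n \<omega>)"
      by (intro covariance_cong)
    also have "\<dots> = \<alpha> m * V m / (2 * \<eta> m) * (\<alpha> n * V n / (2 * \<eta> n)) * excess P t T H G E \<mu> k m n"
      unfolding excess_eq_covariance[OF assms(8) pi theta] X_def
      by (simp only: covariance_cmult_left covariance_cmult_right mult.assoc)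
    finally show ?thesis
      by (simp add: mult_ac)
  qed

  \<comment> \<open>Comparing two expressions for the variance of \<open>R n\<close> shows that the
    diagonal entry equals the square of \<open>\<sigma> n\<close>, since the interval has positive
    length.\<close>
  have \<Sigma>pos: "\<Sigma> $ n $ n > 0" for n
  proof -
    have "covariance P (R n) (R n) = \<sigma> n * (\<sigma> n * (t (k + 1) - t k))"
      unfolding R_def covariance_cmult_left covariance_cmult_right
      using assms(9) t unfolding correlated_wiener_processes_def
      by (subst P.wiener_increment_moments(2)[where X="\<lambda>s \<omega>. W s \<omega> $ n"]) auto
    then show ?thesis
      using t assms(3)[of n] unfolding covR by (simp add: zero_less_mult_iff)
  qed

  \<comment> \<open>Each day has its own exceptional null set; there are countably many
    days.\<close>
  have price: "AE \<omega> in Q. \<forall>l\<ge>1. \<forall>n. price_incr t (\<lambda>l. S l \<omega>) n k l = f n (Y l \<omega>)"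
  proof -
    have "AE \<omega> in Q. \<forall>n. price_incr t (\<lambda>l. S l \<omega>) n k l = f n (Y l \<omega>)" if l: "l \<ge> 1" for l
      using assms(24)[OF l] AE_space
    proof eventually_elim
      case (elim \<omega>)
      have sol: "mean_field_solution T (VV V \<eta>) (diag_mat \<alpha>) (diag_mat A) \<gamma> \<Sigma> (E\<^sub>0d l \<omega>) (Ed l \<omega>) (\<mu>d l \<omega>)"
        using assms(23)[OF l elim(2)] .
      show ?case
      proof
        fix n
        have "(\<lambda>r. \<alpha> n * \<mu>d l \<omega> r $ n) integrable_on {0..t (k + 1)}"
          using t by (intro integrable_continuous_real continuous_intros
              continuous_on_subset[OF mean_field_solution_continuous(2)[OF sol]]) auto
        then have "integral {0..t (k + 1)} (\<lambda>r. \<alpha> n * \<mu>d l \<omega> r $ n) =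
            integral {0..t k} (\<lambda>r. \<alpha> n * \<mu>d l \<omega> r $ n) +
            \<alpha> n * integral {t k..t (k + 1)} (\<lambda>r. \<mu>d l \<omega> r $ n)"
          using t Henstock_Kurzweil_Integration.integral_combine[of 0 "t k" "t (k + 1)"] by fastforce
        then show "price_incr t (\<lambda>l. S l \<omega>) n k l = f n (Y l \<omega>)"
          using elim(1)[rule_format, OF tT(1), of n] elim(1)[rule_format, OF tT(2), of n] drift[OF sol, of n] tT
          by (simp add: price_incr_def f_def Y_def path_on_def algebra_simps)
      qed
    qed
    then have "AE \<omega> in Q. l \<ge> 1 \<longrightarrow> (\<forall>n. price_incr t (\<lambda>l. S l \<omega>) n k l = f n (Y l \<omega>))" for l
      by (cases "l \<ge> 1") auto
    then show ?thesis
      by (simp add: AE_all_countable)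
  qed

  define C where "C m n = (t (k + 1) - t k) * \<Sigma> $ m $ n + covariance P (D m) (D n)" for m n
  have conv: "AE \<omega> in Q. (\<lambda>N. sample_cov t (\<lambda>l. S l \<omega>) N k m n) \<longlonglongrightarrow> C m n" for m n
  proof -
    have slln: "AE \<omega> in Q. (\<lambda>N. (\<Sum>l=1..N. g (Y l \<omega>)) / real N) \<longlonglongrightarrow> (LINT \<omega>|P. g (Z \<omega>))"
      if "g \<in> borel_measurable (borel \<Otimes>\<^sub>M path_space T)" "integrable P (\<lambda>\<omega>. g (Z \<omega>))" for g
      using assms(21,22) Zm that unfolding Y_def[abs_def] Z_def[abs_def]
      by (intro strong_law_of_large_numbers_copies[OF assms(20)]) auto
    have "AE \<omega> in Q. (\<lambda>N. (\<Sum>l=1..N. f m (Y l \<omega>) * f n (Y l \<omega>)) / real N) \<longlonglongrightarrow>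
        (LINT \<omega>|P. f m (Z \<omega>) * f n (Z \<omega>))"
      by (intro slln square_integrable_mult RD) measurable
    moreover have "AE \<omega> in Q. (\<lambda>N. (\<Sum>l=1..N. f n (Y l \<omega>)) / real N) \<longlonglongrightarrow> (LINT \<omega>|P. f n (Z \<omega>))" for n
      by (intro slln P.square_integrable_integrable RD fm)
    note this[of m] this[of n]
    ultimately show ?thesis
      using price
    proof eventually_elim
      case (elim \<omega>)
      have sums: "(\<Sum>l=1..N. price_incr t (\<lambda>l. S l \<omega>) n k l) = (\<Sum>l=1..N. f n (Y l \<omega>))"
        "(\<Sum>l=1..N. price_incr t (\<lambda>l. S l \<omega>) m k l * price_incr t (\<lambda>l. S l \<omega>) n k l) =
          (\<Sum>l=1..N. f m (Y l \<omega>) * f n (Y l \<omega>))" for N m n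
        using elim(4) by (auto intro!: sum.cong)
      have "C m n = (LINT \<omega>|P. f m (Z \<omega>) * f n (Z \<omega>)) - (LINT \<omega>|P. f m (Z \<omega>)) * (LINT \<omega>|P. f n (Z \<omega>))"
        unfolding C_def covZ[symmetric] by (rule P.covariance_eq[OF RD RD])
      moreover have "(\<lambda>N. sample_cov t (\<lambda>l. S l \<omega>) N k m n) \<longlonglongrightarrow>
        (LINT \<omega>|P. f m (Z \<omega>) * f n (Z \<omega>)) - (LINT \<omega>|P. f m (Z \<omega>)) * (LINT \<omega>|P. f n (Z \<omega>))"
        by (intro sample_cov_tendsto; simp only: sums elim)
      ultimately show ?case
        by simp
    qed
  qed
  \<comment> \<open>The Brownian variance keeps the limit of the denominator away from 0, whatever
    the drift contributes.\<close>
  have Cpos: "C n n > 0" for n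
    unfolding C_def using t \<Sigma>pos[of n] P.covariance_self_nonneg[of "D n"]
    by (intro add_pos_nonneg mult_pos_pos) auto

  define \<epsilon> where "\<epsilon> N \<omega> = estimated_corr t (\<lambda>l. S l \<omega>) N k i j - \<rho> i j * A_coeff t \<Sigma> (\<lambda>l. S l \<omega>) N k i j
         - B_coeff t \<alpha> V \<eta> (excess P t T H G E \<mu> k) (\<lambda>l. S l \<omega>) N k i j" for N \<omega>
  \<comment> \<open>All three terms share the denominator
    \<open>sqrt (C\<^sub>i\<^sub>i C\<^sub>j\<^sub>j)\<close> of sample variances. The identity also
    holds where this vanishes, since every quotient is then 0.\<close>
  have \<epsilon>: "\<epsilon> N \<omega> = (sample_cov t (\<lambda>l. S l \<omega>) N k i j - C i j) /
      sqrt (sample_cov t (\<lambda>l. S l \<omega>) N k i i * sample_cov t (\<lambda>l. S l \<omega>) N k j j)" for N \<omega>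
  proof -
    have "\<rho> i j * A_coeff t \<Sigma> (\<lambda>l. S l \<omega>) N k i j = (t (k + 1) - t k) * \<Sigma> $ i $ j /
        sqrt (sample_cov t (\<lambda>l. S l \<omega>) N k i i * sample_cov t (\<lambda>l. S l \<omega>) N k j j)"
      unfolding A_coeff_def assms(28) real_sqrt_divide real_sqrt_mult[of "(_)\<^sup>2"]
      using t \<Sigma>pos[of i] \<Sigma>pos[of j] by (simp add: real_sqrt_mult)
    then show ?thesis
      unfolding \<epsilon>_def C_def covD estimated_corr_def B_coeff_def by (simp add: diff_divide_distrib add_divide_distrib)
  qed
  have "AE \<omega> in Q. (\<lambda>N. \<epsilon> N \<omega>) \<longlonglongrightarrow> 0"
    using conv[of i j] conv[of i i] conv[of j j]
  proof eventually_elim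
    case (elim \<omega>)
    have "(\<lambda>N. \<epsilon> N \<omega>) \<longlonglongrightarrow> (C i j - C i j) / sqrt (C i i * C j j)"
      unfolding \<epsilon> using Cpos[of i] Cpos[of j] by (intro tendsto_intros elim) auto
    then show ?case
      by simp
  qed
  then show ?thesis
    by (intro exI[of _ \<epsilon>]) (simp add: \<epsilon>_def)
qed

end
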